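(* Let $k$ be an algebraically closed field of characteristic zero. Let $f\in k[[X,Y]]$ be an irreducible power series of order $n\ge 2$ which is not quasi-homogeneous. Let $R=k[[x,y]]:=\frac{k[[X,Y]]}{(f)}$, where $x,y$ are the residue classes of $X,Y$, and let $D$ be a nonzero $k$-derivation of $R$. Let $k[[t]]$ be an integral closure of $R=k[[x,y]]$ in its field of fractions. Suppose $D$ is induced by a $k$-derivation $a(t)\frac{d}{dt}:k[[t]]\to k[[t]]$ for some $a(t)\in k[[t]]$. If $r:=\mathrm{ord}_t(a)$, then $r\ge n+1$.
   Context: The order of a nonzero $f\in k[[X,Y]]$ is the largest non-negative integer $i$ with $f\in\mathfrak M^i$, where $\mathfrak M=(X,Y)$ is the maximal ideal. A pair of variables of $k[[X,Y]]$ is a pair $U,V\in\mathfrak M$ with $k[[U,V]]=k[[X,Y]]$. An irreducible power series $f\in k[[X,Y]]$ of order $>1$ is called quasi-homogeneous if there exists a pair of variables $U,V$ of $k[[X,Y]]$ such that $(f)=(V^p-U^q)$ for some positive integers $p,q\ge 2$ (necessarily relatively prime); equivalently, $k[[X,Y]]/(f)$ is isomorphic as a $k$-algebra to $k[[t^p,t^q]]$ for some relatively prime integers $p,q\ge 2$. The integral closure $\overline R$ of $R=k[[X,Y]]/(f)$ in its field of fractions is isomorphic to $k[[t]]$, with $t$ corresponding to a uniformizing parameter, and $R$ is regarded as a subring of $k[[t]]$. For a nonzero $a\in k[[t]]$, $\mathrm{ord}_t(a)$ is the smallest power of $t$ appearing in $a$ with nonzero coefficient. Every $k$-derivation of $k[[t]]$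 has the form $a(t)\frac{d}{dt}$ with $a(t)\in k[[t]]$, and every $k$-derivation of $R$ extends uniquely to a $k$-derivation of $k[[t]]$; one says $a(t)\frac{d}{dt}$ induces a $k$-derivation of $R$ if $a(t)\frac{dr}{dt}\in R$ for all $r\in R$, the induced derivation being its restriction to $R$. *)

theory Defs
  imports
    "HOL-Computational_Algebra.Formal_Laurent_Series"
    "HOL-Algebra.Ideal_Product"
    "HOL-Algebra.QuotRing"
    "HOL-Algebra.Algebraic_Closure_Type"
begin

text \<open>
  The ring k[[X,Y]] is the type of power series in Y over k[[X]]: the coefficient of
  \<open>X^i Y^j\<close> in \<open>f\<close> is \<open>fps_nth (fps_nth f j) i\<close>.  It is also viewed as a ring with carrier,
  so that ideals, their products and quotients are those of the algebra library.
\<close>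

abbreviation kXY :: "'a::field fps fps ring" where
  "kXY \<equiv> ring_of_type_algebra"

definition varX :: "'a::field fps fps" where
  "varX = fps_const fps_X"

definition varY :: "'a::field fps fps" where
  "varY = fps_X"

definition const2 :: "'a::field \<Rightarrow> 'a fps fps" where
  "const2 c = fps_const (fps_const c)"

definition max_ideal :: "'a::field fps fps set" where
  "max_ideal = Idl\<^bsub>kXY\<^esub> {varX, varY}"

definition max_ideal_pow :: "nat \<Rightarrow> 'a::field fps fps set" where
  "max_ideal_pow i = max_ideal [^]\<^bsub>ideals_set kXY\<^esub> i"

text \<open>Meaningful for nonzero \<open>f\<close> only.\<close>

definition ps_order :: "'a::field fps fps \<Rightarrow> nat" where
  "ps_order f = (GREATEST i. f \<in> max_ideal_pow i)"

text \<open>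
  For \<open>U\<close>, \<open>V\<close> in the maximal ideal, k[[U,V]] is the set of sums of the series
  \<open>\<Sum> c i j U^i V^j\<close>; convergence is in the topology of the powers of the maximal ideal
  (the terms with \<open>i + j \<ge> N\<close> lie in its \<open>N\<close>-th power).  The topology that the library puts
  on \<open>fps\<close> is not this one, since it ignores powers of X.
\<close>

definition ps_subring :: "'a::field fps fps \<Rightarrow> 'a fps fps \<Rightarrow> 'a fps fps set" where
  "ps_subring U V =
     {h. \<exists>c :: nat \<Rightarrow> nat \<Rightarrow> 'a. \<forall>N.
        h - (\<Sum>(i, j) \<in> {(i, j). i + j < N}. const2 (c i j) * U ^ i * V ^ j) \<in> max_ideal_pow N}"

definition pair_of_variables :: "'a::field fps fps \<Rightarrow> 'a fps fps \<Rightarrow> bool" where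
  "pair_of_variables U V \<longleftrightarrow> U \<in> max_ideal \<and> V \<in> max_ideal \<and> ps_subring U V = UNIV"

definition quasi_homogeneous :: "'a::field fps fps \<Rightarrow> bool" where
  "quasi_homogeneous f \<longleftrightarrow>
     Factorial_Ring.irreducible f \<and> ps_order f > 1 \<and>
     (\<exists>U V p q. pair_of_variables U V \<and> p \<ge> 2 \<and> q \<ge> 2 \<and>
        PIdl\<^bsub>kXY\<^esub> f = PIdl\<^bsub>kXY\<^esub> (V ^ p - U ^ q))"

definition curve_ring :: "'a::field fps fps \<Rightarrow> 'a fps fps set ring" where
  "curve_ring f = kXY Quot (PIdl\<^bsub>kXY\<^esub> f)"

definition curve_const :: "'a::field fps fps \<Rightarrow> 'a \<Rightarrow> 'a fps fps set" where
  "curve_const f c = PIdl\<^bsub>kXY\<^esub> f +>\<^bsub>kXY\<^esub> const2 c"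

text \<open>The map \<open>\<kappa>\<close> is the structure map of the k-algebra \<open>R\<close>.\<close>

definition k_derivation :: "('b, 'm) ring_scheme \<Rightarrow> ('a \<Rightarrow> 'b) \<Rightarrow> ('b \<Rightarrow> 'b) \<Rightarrow> bool" where
  "k_derivation R \<kappa> D \<longleftrightarrow>
     D \<in> carrier R \<rightarrow> carrier R \<and>
     (\<forall>u\<in>carrier R. \<forall>v\<in>carrier R. D (u \<oplus>\<^bsub>R\<^esub> v) = D u \<oplus>\<^bsub>R\<^esub> D v) \<and>
     (\<forall>c. \<forall>u\<in>carrier R. D (\<kappa> c \<otimes>\<^bsub>R\<^esub> u) = \<kappa> c \<otimes>\<^bsub>R\<^esub> D u) \<and>
     (\<forall>u\<in>carrier R. \<forall>v\<in>carrier R.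
        D (u \<otimes>\<^bsub>R\<^esub> v) = (u \<otimes>\<^bsub>R\<^esub> D v) \<oplus>\<^bsub>R\<^esub> (D u \<otimes>\<^bsub>R\<^esub> v))"

text \<open>Field of fractions and integral closure of a subring \<open>S\<close> of a field.\<close>

definition fractions :: "'b::field set \<Rightarrow> 'b set" where
  "fractions S = {a / b | a b. a \<in> S \<and> b \<in> S \<and> b \<noteq> 0}"

definition integral_over :: "'b::comm_ring_1 set \<Rightarrow> 'b \<Rightarrow> bool" where
  "integral_over S z \<longleftrightarrow>
     (\<exists>m c. m > 0 \<and> (\<forall>i<m. c i \<in> S) \<and> z ^ m + (\<Sum>i<m. c i * z ^ i) = 0)"

definition integral_closure :: "'b::field set \<Rightarrow> 'b set" where
  "integral_closure S = {z \<in> fractions S. integral_over S z}"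

text \<open>
  The map \<open>\<iota>\<close> embeds R = k[[X,Y]]/(f) as a k-subalgebra of k[[t]] such that k[[t]] is the
  integral closure of R in its field of fractions.  Fractions are formed inside k((t)), the
  field of formal Laurent series.
\<close>

definition normalization :: "'a::field fps fps \<Rightarrow> ('a fps fps set \<Rightarrow> 'a fps) \<Rightarrow> bool" where
  "normalization f \<iota> \<longleftrightarrow>
     \<iota> \<in> ring_hom (curve_ring f) ring_of_type_algebra \<and>
     inj_on \<iota> (carrier (curve_ring f)) \<and>
     (\<forall>c. \<iota> (curve_const f c) = fps_const c) \<and>
     integral_closure (fps_to_fls ` \<iota> ` carrier (curve_ring f)) = range fps_to_fls"

text \<open>
  \<open>D\<close> is the restriction to R of the derivation \<open>a(t) d/dt\<close> of k[[t]].
\<close>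

definition induced_by ::
    "'a::field fps fps \<Rightarrow> ('a fps fps set \<Rightarrow> 'a fps) \<Rightarrow> 'a fps
      \<Rightarrow> ('a fps fps set \<Rightarrow> 'a fps fps set) \<Rightarrow> bool" where
  "induced_by f \<iota> a D \<longleftrightarrow>
     (\<forall>u\<in>carrier (curve_ring f).
        a * fps_deriv (\<iota> u) \<in> \<iota> ` carrier (curve_ring f) \<and>
        \<iota> (D u) = a * fps_deriv (\<iota> u))"

end

theory Submission
  imports Defs
begin

text \<open>
  Let \<open>S\<close> be the image of \<open>k[[X,Y]]\<close> in \<open>k[[t]]\<close>. Everything is read off from the orders of the elements
  of \<open>S\<close>: in characteristic zero \<open>D = a d/dt\<close> adds exactly \<open>r - 1\<close> to the order of each
  nonzero nonunit, and \<open>S\<close> has few orders.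

  Let \<open>e\<close> be the least positive order in \<open>S\<close>, attained by the image \<open>x\<close> of a coordinate. As \<open>k[[t]]\<close> has
  \<open>e\<close> generators over \<open>k[[x]]\<close>, the other coordinate satisfies a relation of degree \<open>e\<close> over \<open>k[[x]]\<close>,
  which gives \<open>n \<le> e\<close> (\<open>order_le_branch_order\<close>). It remains to show that \<open>r \<le> e\<close> forces \<open>f\<close> to be
  quasi-homogeneous. Subtracting a power series in \<open>x\<close>, one may take the second generator \<open>y\<close> of \<open>S\<close> to
  have an order \<open>m\<close> that is not a multiple of \<open>e\<close>. Every element of \<open>S\<close> is of the form \<open>p(x) + y g\<close>
  with \<open>g\<close> in \<open>S\<close>, so its order is a multiple of \<open>e\<close>, or \<open>m\<close>, or at least \<open>m + e\<close>. For the elements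
  \<open>D x\<close> and \<open>D y\<close> of \<open>S\<close> this leaves two possibilities (\<open>derivation_order_cases\<close>): \<open>r = 1\<close>, or
  \<open>r = h + 1\<close>, \<open>e = 2 h\<close> and \<open>m = 3 h\<close> with \<open>h > 0\<close>.

  If \<open>r = 1\<close>, then \<open>D\<close> is \<open>c \<tau> d/d\<tau>\<close> for a uniformizer \<open>\<tau>\<close>, and projecting \<open>x\<close> and \<open>y\<close> to eigenvectors of
  \<open>D\<close> shows that \<open>\<tau>^e\<close> and \<open>\<tau>^m\<close> are in \<open>S\<close>. In the other case, if \<open>h \<ge> 2\<close>, there is an element
  \<open>w = y^2 - p(x) - q(x) y\<close> of \<open>S\<close> whose order \<open>s\<close> is not a multiple of \<open>h\<close>, and \<open>S\<close> has no
  element of the order \<open>s + h\<close> of \<open>D w\<close> (\<open>no_derivation_beyond_cusp\<close>). If \<open>h = 1\<close>, then \<open>S\<close> contains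
  all powers of \<open>t\<close> but \<open>t\<close> itself, in particular \<open>t^2\<close> and \<open>t^3\<close>.

  So \<open>S\<close> contains \<open>\<tau>^e\<close> and \<open>\<tau>^m\<close> for some uniformizer \<open>\<tau>\<close>. Preimages \<open>U\<close>, \<open>V\<close> of them form a pair of
  variables, because no nontrivial linear combination of \<open>\<tau>^e\<close> and \<open>\<tau>^m\<close> is in the square of the
  maximal ideal of \<open>S\<close>. The exponents are coprime since \<open>k[[t]]\<close> is the normalization of \<open>S\<close>. Finally
  \<open>V^e - U^m\<close> is a multiple of \<open>f\<close>; as it has order \<open>e\<close> and \<open>f\<close> has no terms of degree
  less than \<open>e\<close> in \<open>U\<close>, \<open>V\<close>, it differs from \<open>f\<close> by a unit (\<open>branch_equation\<close>).
\<close>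

section \<open>Orders of power series in one variable\<close>

lemma X_power_dvd_iff_subdegree:
  fixes g :: "'a::field fps"
  shows "fps_X ^ N dvd g \<longleftrightarrow> g = 0 \<or> N \<le> subdegree g"
  by (cases "g = 0") (simp_all add: fps_dvd_iff fps_X_power_subdegree)

lemma X_power_dvd_iff_nth:
  fixes g :: "'a::field fps"
  shows "fps_X ^ N dvd g \<longleftrightarrow> (\<forall>i<N. fps_nth g i = 0)"
proof
  assume "fps_X ^ N dvd g"
  then obtain k where "g = fps_X ^ N * k" ..
  then show "\<forall>i<N. fps_nth g i = 0" by (simp add: fps_X_power_mult_nth)
next
  assume *: "\<forall>i<N. fps_nth g i = 0"
  have "g = fps_X ^ N * fps_shift N g"
    by (rule fps_ext) (simp add: fps_X_power_mult_nth *)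
  then show "fps_X ^ N dvd g" by (rule dvdI)
qed

lemma eq_0_if_X_powers_dvd:
  fixes g :: "'a::field fps"
  assumes "\<And>N. fps_X ^ N dvd g"
  shows "g = 0"
  by (rule fps_ext) (use assms X_power_dvd_iff_nth in \<open>metis fps_zero_nth lessI\<close>)

text \<open>
  The order of a sum is the order of a summand, unless the two leading terms cancel. Most of the
  arguments below are a case distinction of this kind on possible orders.
\<close>

lemma subdegree_add_cases:
  fixes u v :: "'a::field fps"
  assumes "u + v \<noteq> 0"
  obtains "u \<noteq> 0" "subdegree (u + v) = subdegree u"
    | "v \<noteq> 0" "subdegree (u + v) = subdegree v"
    | "u \<noteq> 0" "v \<noteq> 0" "subdegree u = subdegree v" "subdegree u < subdegree (u + v)"
proof -
  consider "u = 0" | "v = 0" | "u \<noteq> 0" "v \<noteq> 0" "subdegree u < subdegree v"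
    | "u \<noteq> 0" "v \<noteq> 0" "subdegree v < subdegree u" | "u \<noteq> 0" "v \<noteq> 0" "subdegree u = subdegree v"
    by linarith
  then show ?thesis
  proof cases
    case 5
    then have "subdegree u \<le> subdegree (u + v)"
      using subdegree_add_ge'[OF assms] by simp
    then show ?thesis using that 5 by (cases "subdegree u = subdegree (u + v)") auto
  qed (use that assms subdegree_add_eq1 subdegree_add_eq2 in \<open>auto\<close>)
qed

lemma subdegree_derivation:
  fixes a s :: "'a::field_char_0 fps"
  assumes "a \<noteq> 0" "s \<noteq> 0" "fps_nth s 0 = 0"
  shows "a * fps_deriv s \<noteq> 0" "subdegree (a * fps_deriv s) = subdegree a + subdegree s - 1"
proof -
  have "subdegree s \<noteq> 0" using assms by (metis nth_subdegree_nonzero)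
  then obtain n where n: "subdegree s = Suc n" by (cases "subdegree s") auto
  have "fps_nth s (Suc n) \<noteq> 0" using nth_subdegree_nonzero[OF assms(2)] n by simp
  then have nz: "fps_nth (fps_deriv s) n \<noteq> 0" by (simp del: of_nat_Suc)
  have "fps_nth (fps_deriv s) i = 0" if "i < n" for i
    using that n nth_less_subdegree_zero[of "Suc i" s] by simp
  then have "subdegree (fps_deriv s) = n"
    using nz by (intro subdegreeI)
  moreover have "fps_deriv s \<noteq> 0" using nz by (metis fps_zero_nth)
  ultimately show "a * fps_deriv s \<noteq> 0"
      "subdegree (a * fps_deriv s) = subdegree a + subdegree s - 1"
    using assms(1) n by auto
qed

lemma fps_X_times_compose:
  fixes p x :: "'a::field fps"
  assumes "fps_nth x 0 = 0"
  shows "x * (p oo x) = (fps_X * p) oo x"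
  using assms by (simp add: fps_compose_mult_distrib)

lemma dvd_compose_minus_truncation:
  fixes p x :: "'a::field fps"
  assumes "fps_nth x 0 = 0"
  shows "fps_X ^ K dvd (p oo x) - (\<Sum>i<K. fps_const (fps_nth p i) * x ^ i)"
proof -
  define q where "q = (\<Sum>i<K. fps_const (fps_nth p i) * fps_X ^ i)"
  have "fps_X ^ K dvd p - q"
    unfolding X_power_dvd_iff_nth q_def
    by (auto simp: fps_sum_nth fps_X_power_nth if_distrib sum.delta cong: if_cong)
  then obtain r where r: "p - q = fps_X ^ K * r" ..
  have "q oo x = (\<Sum>i<K. fps_const (fps_nth p i) * x ^ i)"
    unfolding q_def fps_compose_sum_distrib
    using assms by (simp add: fps_compose_mult_distrib fps_X_power_compose)
  then have "(p oo x) - (\<Sum>i<K. fps_const (fps_nth p i) * x ^ i) = (p - q) oo x"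
    by (simp add: fps_compose_sub_distrib)
  also have "\<dots> = x ^ K * (r oo x)"
    unfolding r using assms by (simp add: fps_compose_mult_distrib fps_X_power_compose)
  finally have eq: "(p oo x) - (\<Sum>i<K. fps_const (fps_nth p i) * x ^ i) = x ^ K * (r oo x)" .
  have "fps_X ^ 1 dvd x" using assms unfolding X_power_dvd_iff_nth by simp
  then have "fps_X ^ K dvd x ^ K" using dvd_power_same[of fps_X x K] by simp
  then show ?thesis unfolding eq by simp
qed

text \<open>
  Killing leading terms one by one: as long as the order of the current remainder \<open>z - b\<close> is the
  order of some element of \<open>B\<close>, the remainder can be pushed further, so either this continues up to
  the given precision or it stops at an order outside \<open>\<Sigma>\<close>.
\<close>

lemma approximation_or_gap:
  fixes B :: "'a::field fps set" and \<Sigma> :: "nat set"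
  assumes zero: "0 \<in> B"
    and add: "\<And>u v. u \<in> B \<Longrightarrow> v \<in> B \<Longrightarrow> u + v \<in> B"
    and scale: "\<And>c u. u \<in> B \<Longrightarrow> fps_const c * u \<in> B"
    and orders: "\<And>k. k \<in> \<Sigma> \<Longrightarrow> \<exists>b\<in>B. b \<noteq> 0 \<and> subdegree b = k"
  obtains b where "b \<in> B" "fps_X ^ N dvd z - b"
    | b where "b \<in> B" "z - b \<noteq> 0" "subdegree (z - b) \<notin> \<Sigma>"
proof -
  have "(\<exists>b\<in>B. fps_X ^ N dvd z - b) \<or> (\<exists>b\<in>B. z - b \<noteq> 0 \<and> subdegree (z - b) \<notin> \<Sigma>)"
  proof (induction N)
    case 0
    then show ?case using zero by auto
  next
    case (Suc N)
    show ?case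
    proof (cases "\<exists>b\<in>B. z - b \<noteq> 0 \<and> subdegree (z - b) \<notin> \<Sigma>")
      case False
      with Suc obtain b where b: "b \<in> B" "fps_X ^ N dvd z - b" by auto
      define d where "d = z - b"
      have low: "\<forall>i<N. d $ i = 0" using b(2) unfolding d_def X_power_dvd_iff_nth .
      show ?thesis
      proof (cases "d $ N = 0")
        case True
        then have "fps_X ^ Suc N dvd d" unfolding X_power_dvd_iff_nth using low less_Suc_eq by auto
        then show ?thesis using b(1) d_def by blast
      next
        case nz: False
        have "subdegree d = N" using nz low by (intro subdegreeI) auto
        then have "N \<in> \<Sigma>" using False b(1) nz unfolding d_def by (metis fps_zero_nth)
        then obtain b' where b': "b' \<in> B" "b' \<noteq> 0" "subdegree b' = N" using orders by blast
        define c where "c = d $ N / b' $ N"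
        have b'N: "b' $ N \<noteq> 0" using b' nth_subdegree_nonzero by blast
        have "(d - fps_const c * b') $ i = 0" if "i < Suc N" for i
        proof (cases "i = N")
          case True then show ?thesis using b'N by (simp add: c_def)
        next
          case False
          then have "i < N" using that by simp
          then have "b' $ i = 0" using b'(3) nth_less_subdegree_zero[of i b'] by blast
          then show ?thesis using low \<open>i < N\<close> by simp
        qed
        then have "fps_X ^ Suc N dvd d - fps_const c * b'" unfolding X_power_dvd_iff_nth by blast
        moreover have "d - fps_const c * b' = z - (b + fps_const c * b')" by (simp add: d_def)
        ultimately show ?thesis using add scale b(1) b'(1) by metis
      qed
    qed auto
  qed
  then show ?thesis using that by auto
qed

text \<open>
  Each coefficient is dictated by the leading term of the remainder left by the previous ones.
\<close>

lemma triangular_expansion: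
  fixes h :: "'a::field fps" and b :: "nat \<Rightarrow> 'a fps"
  assumes "\<And>m. b m \<noteq> 0" "\<And>m. subdegree (b m) = m"
  obtains c where "\<And>M. fps_X ^ M dvd h - (\<Sum>m<M. fps_const (c m) * b m)"
proof -
  define p where "p = rec_nat 0 (\<lambda>M q. q + fps_const ((h - q) $ M / b M $ M) * b M)"
  define c where "c M = (h - p M) $ M / b M $ M" for M
  have p0: "p 0 = 0" and pS: "p (Suc M) = p M + fps_const (c M) * b M" for M
    by (simp_all add: p_def c_def)
  have p: "p M = (\<Sum>m<M. fps_const (c m) * b m)" for M
    by (induction M) (simp_all add: p0 pS)
  have "fps_X ^ M dvd h - p M" for M
  proof (induction M)
    case (Suc M)
    have nz: "b M $ M \<noteq> 0" using assms[of M] by (metis nth_subdegree_nonzero)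
    have "(h - p (Suc M)) $ i = 0" if "i < Suc M" for i
    proof (cases "i = M")
      case True
      then show ?thesis using nz by (simp add: pS c_def)
    next
      case False
      then have "i < M" using that by simp
      then have "b M $ i = 0" using assms(2)[of M] nth_less_subdegree_zero[of i "b M"] by metis
      then show ?thesis using Suc \<open>i < M\<close> unfolding X_power_dvd_iff_nth by (simp add: pS)
    qed
    then show ?case unfolding X_power_dvd_iff_nth by blast
  qed simp
  then show ?thesis using that unfolding p by blast
qed

text \<open>
  With \<open>e = ord x\<close>, the products \<open>x^i t^j\<close> with \<open>j < e\<close> have each order exactly once, namely
  \<open>e i + j\<close>. Collecting the expansion along them by \<open>j\<close> exhibits \<open>k[[t]]\<close> as generated by
  \<open>1, t, ..., t^(e-1)\<close> over \<open>k[[x]]\<close>.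
\<close>

lemma generated_over_subseries:
  fixes x h :: "'a::field fps"
  assumes x0: "fps_nth x 0 = 0" and "x \<noteq> 0"
  obtains c where "h = (\<Sum>j<subdegree x. (c j oo x) * fps_X ^ j)"
proof -
  define e where "e = subdegree x"
  have epos: "e > 0" using assms unfolding e_def by (metis nth_subdegree_nonzero neq0_conv)
  define b where "b m = x ^ (m div e) * fps_X ^ (m mod e)" for m
  have b0: "b m \<noteq> 0" for m using assms(2) by (simp add: b_def)
  have "subdegree (b m) = e * (m div e) + m mod e" for m
    using assms(2) by (simp add: b_def e_def fps_X_power_subdegree)
  then have bm: "subdegree (b m) = m" for m by simp
  obtain \<gamma> where \<gamma>: "\<And>M. fps_X ^ M dvd h - (\<Sum>m<M. fps_const (\<gamma> m) * b m)"
    using triangular_expansion[of b h] b0 bm by blast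
  \<comment> \<open>the coefficients whose index is \<open>j\<close> modulo \<open>e\<close>\<close>
  define c where "c j = Abs_fps (\<lambda>i. \<gamma> (i * e + j))" for j
  define H where "H = (\<Sum>j<e. (c j oo x) * fps_X ^ j)"
  have block: "(\<Sum>m=i*e..<i*e+e. F m) = (\<Sum>j<e. F (i * e + j))" for i and F :: "nat \<Rightarrow> 'a fps"
    by (rule sum.reindex_bij_witness[of _ "\<lambda>j. i * e + j" "\<lambda>m. m - i * e"]) auto
  have "fps_X ^ K dvd h - H" for K
  proof -
    define Q where "Q = (\<Sum>m<K * e. fps_const (\<gamma> m) * b m)"
    have "Q = (\<Sum>i<K. \<Sum>m=i*e..<i*e+e. fps_const (\<gamma> m) * b m)"
      unfolding Q_def by (rule sum.nat_group[symmetric])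
    also have "\<dots> = (\<Sum>i<K. \<Sum>j<e. fps_const (\<gamma> (i * e + j)) * b (i * e + j))"
      by (simp only: block)
    also have "\<dots> = (\<Sum>j<e. \<Sum>i<K. fps_const (\<gamma> (i * e + j)) * b (i * e + j))"
      by (rule sum.swap)
    also have "\<dots> = (\<Sum>j<e. (\<Sum>i<K. fps_const (c j $ i) * x ^ i) * fps_X ^ j)"
      unfolding sum_distrib_right
      by (intro sum.cong refl) (use epos in \<open>simp add: c_def b_def\<close>)
    finally have "H - Q = (\<Sum>j<e. ((c j oo x) - (\<Sum>i<K. fps_const (c j $ i) * x ^ i)) * fps_X ^ j)"
      by (simp add: H_def sum_subtractf algebra_simps)
    then have 1: "fps_X ^ K dvd H - Q"
      using dvd_compose_minus_truncation[OF x0] by (simp add: dvd_sum dvd_mult2)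
    have "K \<le> K * e" using epos by simp
    then have 2: "fps_X ^ K dvd h - Q"
      using \<gamma>[of "K * e"] unfolding Q_def by (meson dvd_trans le_imp_power_dvd)
    have "h - H = (h - Q) - (H - Q)" by simp
    then show ?thesis using dvd_diff[OF 2 1] by simp
  qed
  then have "h = H" using eq_0_if_X_powers_dvd[of "h - H"] by simp
  then show ?thesis using that unfolding H_def e_def by blast
qed

section \<open>Linear dependence over a domain\<close>

text \<open>
  Fraction-free Gaussian elimination: a pivot in the column \<open>j\<close> clears that column in all other
  rows, at the price of multiplying them by the pivot, which is not a zero divisor.
\<close>

lemma linear_relation_over_domain:
  fixes v :: "'i \<Rightarrow> 'j \<Rightarrow> 'b::idom"
  assumes "finite J" "finite I" "card J < card I"
  shows "\<exists>c. (\<exists>i\<in>I. c i \<noteq> 0) \<and> (\<forall>j\<in>J. (\<Sum>i\<in>I. c i * v i j) = 0)"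
  using assms
proof (induction J arbitrary: I v rule: finite_induct)
  case empty
  then obtain i where "i \<in> I" by (metis card.empty less_not_refl ex_in_conv)
  then show ?case by (intro exI[of _ "\<lambda>_. 1"]) auto
next
  case (insert j J)
  show ?case
  proof (cases "\<forall>i\<in>I. v i j = 0")
    case True
    obtain c where "\<exists>i\<in>I. c i \<noteq> 0" "\<forall>j\<in>J. (\<Sum>i\<in>I. c i * v i j) = 0"
      using insert.IH[of I v] insert.prems insert.hyps by auto
    then show ?thesis using True by (intro exI[of _ c]) auto
  next
    case False
    then obtain k where k: "k \<in> I" "v k j \<noteq> 0" by blast
    define w where "w i l = v k j * v i l - v i j * v k l" for i l
    have "card J < card (I - {k})" using insert k by (simp add: card_Diff_singleton)
    then obtain c where c: "\<exists>i\<in>I - {k}. c i \<noteq> 0"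
        "\<forall>l\<in>J. (\<Sum>i\<in>I - {k}. c i * w i l) = 0"
      using insert.IH[of "I - {k}" w] insert.prems by auto
    define c' where "c' i = (if i = k then - (\<Sum>i\<in>I - {k}. c i * v i j) else v k j * c i)" for i
    have sum: "(\<Sum>i\<in>I. c' i * v i l) = (\<Sum>i\<in>I - {k}. c i * w i l)" for l
    proof -
      have "(\<Sum>i\<in>I. c' i * v i l) = c' k * v k l + (\<Sum>i\<in>I - {k}. c' i * v i l)"
        using insert.prems k by (simp add: sum.remove)
      also have "(\<Sum>i\<in>I - {k}. c' i * v i l) = (\<Sum>i\<in>I - {k}. v k j * c i * v i l)"
        by (intro sum.cong) (auto simp: c'_def)
      also have "c' k * v k l = - (\<Sum>i\<in>I - {k}. c i * v i j * v k l)"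
        by (simp add: c'_def sum_distrib_right)
      also have "\<dots> + (\<Sum>i\<in>I - {k}. v k j * c i * v i l) = (\<Sum>i\<in>I - {k}. c i * w i l)"
        unfolding w_def sum_negf[symmetric] sum.distrib[symmetric]
        by (intro sum.cong refl) (simp add: algebra_simps)
      finally show ?thesis .
    qed
    have "\<exists>i\<in>I. c' i \<noteq> 0" using c(1) k unfolding c'_def by auto
    moreover have "(\<Sum>i\<in>I. c' i * v i l) = 0" if "l \<in> insert j J" for l
    proof (cases "l = j")
      case True
      have "w i j = 0" for i by (simp add: w_def algebra_simps)
      then show ?thesis unfolding sum True by simp
    qed (use that c(2) sum in auto)
    ultimately show ?thesis by blast
  qed
qed

section \<open>The complete local ring of a plane branch\<close>

text \<open>
  Unfolding \<open>S = k + x S + y S\<close> repeatedly writes an element of \<open>S\<close> as a polynomial in \<open>x\<close>, \<open>y\<close>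
  plus a remainder of arbitrarily high order. So a set stable under \<open>x\<close> and \<open>y\<close> contains \<open>S\<close> as soon
  as it contains the constants and everything of high order. All descriptions of elements of \<open>S\<close>
  below are obtained by checking these closure properties.
\<close>

lemma subset_of_module_closed:
  fixes S T :: "'a::field fps set"
  assumes generated: "\<And>s. s \<in> S \<Longrightarrow> \<exists>c s1 s2. s1 \<in> S \<and> s2 \<in> S \<and> s = fps_const c + x * s1 + y * s2"
    and x0: "fps_nth x 0 = 0" and y0: "fps_nth y 0 = 0"
    and const: "\<And>c. fps_const c \<in> T"
    and add: "\<And>u v. u \<in> T \<Longrightarrow> v \<in> T \<Longrightarrow> u + v \<in> T"
    and xT: "\<And>u. u \<in> T \<Longrightarrow> x * u \<in> T"
    and yT: "\<And>u. u \<in> T \<Longrightarrow> y * u \<in> T"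
    and high: "\<And>g. fps_X ^ N dvd g \<Longrightarrow> g \<in> T"
  shows "S \<subseteq> T"
proof
  fix s assume "s \<in> S"
  have X: "fps_X dvd x" "fps_X dvd y"
    using x0 y0 X_power_dvd_iff_nth[of 1 x] X_power_dvd_iff_nth[of 1 y] by auto
  have "\<forall>s\<in>S. \<exists>u\<in>T. fps_X ^ k dvd s - u" for k
  proof (induction k)
    case 0
    then show ?case using const by auto
  next
    case (Suc k)
    show ?case
    proof
      fix s assume "s \<in> S"
      then obtain c s1 s2 where s: "s1 \<in> S" "s2 \<in> S" "s = fps_const c + x * s1 + y * s2"
        using generated by blast
      obtain u1 u2 where u: "u1 \<in> T" "u2 \<in> T" "fps_X ^ k dvd s1 - u1" "fps_X ^ k dvd s2 - u2"
        using Suc s by meson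
      have "s - (fps_const c + x * u1 + y * u2) = x * (s1 - u1) + y * (s2 - u2)"
        by (simp add: s algebra_simps)
      moreover have "fps_X ^ Suc k dvd x * (s1 - u1) + y * (s2 - u2)"
        using X u by (simp add: dvd_add mult_dvd_mono)
      ultimately have "fps_X ^ Suc k dvd s - (fps_const c + x * u1 + y * u2)" by simp
      moreover have "fps_const c + x * u1 + y * u2 \<in> T" by (intro add const xT yT u)
      ultimately show "\<exists>u\<in>T. fps_X ^ Suc k dvd s - u" by (rule bexI)
    qed
  qed
  then obtain u where u: "u \<in> T" "fps_X ^ N dvd s - u" using \<open>s \<in> S\<close> by blast
  have "u + (s - u) \<in> T" by (rule add[OF u(1) high[OF u(2)]])
  then show "s \<in> T" by simp
qed

text \<open>
  The branch is considered through its image \<open>S\<close> in \<open>k[[t]]\<close>, generated by two nonunits of which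
  \<open>x\<close> has the smaller order. The conductor condition expresses that \<open>k[[t]]\<close> is the normalization
  of \<open>S\<close>; it also makes \<open>S\<close> closed for the \<open>t\<close>-adic topology, so that limits can be replaced by
  finite approximations.
\<close>

locale plane_branch =
  fixes S :: "'a::field_char_0 fps set" and x y :: "'a fps"
  assumes const_mem: "fps_const c \<in> S"
    and add_mem: "s \<in> S \<Longrightarrow> s' \<in> S \<Longrightarrow> s + s' \<in> S"
    and mult_mem: "s \<in> S \<Longrightarrow> s' \<in> S \<Longrightarrow> s * s' \<in> S"
    and x_mem: "x \<in> S"
    and y_mem: "y \<in> S"
    and generated: "s \<in> S \<Longrightarrow> \<exists>c s1 s2. s1 \<in> S \<and> s2 \<in> S \<and> s = fps_const c + x * s1 + y * s2"
    and conductor: "\<exists>C. \<forall>g. fps_X ^ C dvd g \<longrightarrow> g \<in> S"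
    and two_le_order: "2 \<le> subdegree x"
    and order_le: "fps_X ^ subdegree x dvd y"
begin

abbreviation "e \<equiv> subdegree x"

lemma x0: "fps_nth x 0 = 0"
  by (rule nth_less_subdegree_zero) (use two_le_order in linarith)

lemma x_nonzero: "x \<noteq> 0"
  using two_le_order by (metis not_numeral_le_zero subdegree_0)

lemma y0: "fps_nth y 0 = 0"
proof -
  have "0 < e" using two_le_order by linarith
  then show ?thesis using order_le unfolding X_power_dvd_iff_nth by blast
qed

lemma zero_mem: "0 \<in> S"
  using const_mem[of 0] by simp

lemma one_mem: "1 \<in> S"
  using const_mem[of 1] by simp

lemma diff_mem: "s \<in> S \<Longrightarrow> s' \<in> S \<Longrightarrow> s - s' \<in> S"
  using add_mem[of s "fps_const (-1) * s'"] mult_mem[OF const_mem[of "-1"]]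
  by (simp flip: fps_const_neg)

lemma power_mem: "s \<in> S \<Longrightarrow> s ^ n \<in> S"
  by (induction n) (auto intro: one_mem mult_mem)

lemma sum_mem: "(\<And>i. i \<in> I \<Longrightarrow> f i \<in> S) \<Longrightarrow> sum f I \<in> S"
  by (induction I rule: infinite_finite_induct) (auto intro: zero_mem add_mem)

text \<open>\<open>S\<close> is closed under formal power series in \<open>x\<close>: beyond the conductor every tail is in \<open>S\<close>.\<close>

lemma series_mem: "p oo x \<in> S"
proof -
  obtain C where C: "\<And>g. fps_X ^ C dvd g \<Longrightarrow> g \<in> S" using conductor by blast
  define q where "q = (\<Sum>i<C. fps_const (fps_nth p i) * x ^ i)"
  have "(p oo x) - q \<in> S" unfolding q_def by (rule C[OF dvd_compose_minus_truncation[OF x0]])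
  moreover have "q \<in> S" unfolding q_def by (intro sum_mem mult_mem const_mem power_mem x_mem)
  ultimately show ?thesis using add_mem by fastforce
qed

lemma nonunit_order_ge: "s \<in> S \<Longrightarrow> fps_nth s 0 = 0 \<Longrightarrow> fps_X ^ e dvd s"
proof -
  assume "s \<in> S" and s0: "fps_nth s 0 = 0"
  then obtain c s1 s2 where s: "s = fps_const c + x * s1 + y * s2" using generated by blast
  then have "c = 0" using s0 x0 y0 by simp
  moreover have "fps_X ^ e dvd x" using X_power_dvd_iff_subdegree by blast
  ultimately show ?thesis using s order_le by simp
qed

lemma nonunit_subdegree_ge: "s \<in> S \<Longrightarrow> s \<noteq> 0 \<Longrightarrow> subdegree s = 0 \<or> e \<le> subdegree s"
  using nonunit_order_ge[of s] X_power_dvd_iff_subdegree[of e s]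
  by (metis subdegree_eq_0_iff)

text \<open>
  As \<open>S\<close> contains power series of two consecutive orders, it cannot be approximated to every
  precision by series whose orders are multiples of a fixed integer \<open>\<ge> 2\<close>.
\<close>

lemma not_approximable_by_multiples:
  assumes "2 \<le> d"
    and const: "\<And>c. fps_const c \<in> T"
    and add: "\<And>u v. u \<in> T \<Longrightarrow> v \<in> T \<Longrightarrow> u + v \<in> T"
    and xT: "\<And>u. u \<in> T \<Longrightarrow> x * u \<in> T"
    and yT: "\<And>N u. u \<in> T \<Longrightarrow> \<exists>v\<in>T. fps_X ^ N dvd y * u - v"
    and orders: "\<And>u. u \<in> T \<Longrightarrow> u \<noteq> 0 \<Longrightarrow> d dvd subdegree u"
  shows False
proof -
  obtain C where C: "\<And>g. fps_X ^ C dvd g \<Longrightarrow> g \<in> S" using conductor by blast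
  \<comment> \<open>precise enough to leave the orders \<open>C\<close> and \<open>C + 1\<close> of \<open>S\<close> visible\<close>
  define N where "N = C + 2"
  define T' where "T' = {u + g | u g. u \<in> T \<and> fps_X ^ N dvd g}"
  have T'I: "u + g \<in> T'" if "u \<in> T" "fps_X ^ N dvd g" for u g
    using that unfolding T'_def by blast
  have "S \<subseteq> T'"
  proof (rule subset_of_module_closed[OF generated x0 y0, where N = N])
    show "fps_const c \<in> T'" for c using T'I[OF const[of c], of 0] by simp
    show "u + v \<in> T'" if uv: "u \<in> T'" "v \<in> T'" for u v
    proof -
      obtain u1 g v1 h where "u1 \<in> T" "v1 \<in> T" "fps_X ^ N dvd g" "fps_X ^ N dvd h"
          "u = u1 + g" "v = v1 + h" using uv unfolding T'_def by blast
      moreover from this have "u + v = (u1 + v1) + (g + h)" by simp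
      ultimately show ?thesis using T'I add by (metis dvd_add)
    qed
    show "x * u \<in> T'" if xu: "u \<in> T'" for u
    proof -
      obtain u1 g where u: "u1 \<in> T" "fps_X ^ N dvd g" "u = u1 + g"
        using xu unfolding T'_def by blast
      then show ?thesis using T'I[OF xT[OF u(1)], of "x * g"] by (simp add: distrib_left)
    qed
    show "y * u \<in> T'" if yu: "u \<in> T'" for u
    proof -
      obtain u1 g where u: "u1 \<in> T" "fps_X ^ N dvd g" "u = u1 + g"
        using yu unfolding T'_def by blast
      obtain v where v: "v \<in> T" "fps_X ^ N dvd y * u1 - v" using yT u by blast
      have "y * u = v + ((y * u1 - v) + y * g)" by (simp add: u algebra_simps)
      then show ?thesis using T'I[OF v(1), of "(y * u1 - v) + y * g"] u v by simp
    qed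
    show "g \<in> T'" if "fps_X ^ N dvd g" for g
      using T'I[OF const[of 0] that] by simp
  qed
  have "d dvd k" if "C \<le> k" "k < N" for k
  proof -
    have "fps_X ^ k \<in> S" using C that by (simp add: le_imp_power_dvd)
    then obtain u g where ug: "u \<in> T" "fps_X ^ N dvd g" "fps_X ^ k = u + g"
      using \<open>S \<subseteq> T'\<close> unfolding T'_def by blast
    have u: "u = fps_X ^ k - g" using ug(3) by simp
    have "u \<noteq> 0 \<and> subdegree u = k"
    proof (cases "g = 0")
      case True then show ?thesis by (simp add: u fps_X_power_subdegree)
    next
      case False
      then have "N \<le> subdegree g" using ug(2) X_power_dvd_iff_subdegree by blast
      then have "subdegree u = k"
        unfolding u using that subdegree_diff_eq1[of "fps_X ^ k" g] by (simp add: fps_X_power_subdegree)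
      moreover have "u \<noteq> 0"
        using \<open>N \<le> subdegree g\<close> that u by (metis fps_X_power_subdegree eq_iff_diff_eq_0 not_le)
      ultimately show ?thesis by blast
    qed
    then show ?thesis using orders ug(1) by blast
  qed
  from this[of C] this[of "Suc C"] have "d dvd C" "d dvd Suc C" by (auto simp: N_def)
  then have "d dvd 1" by (metis Suc_eq_plus1 dvd_add_right_iff)
  then show False using assms(1) by simp
qed

text \<open>
  Subtracting from \<open>y\<close> the multiples of powers of \<open>x\<close> that agree with it to leading order, one
  reaches an order that is not a multiple of that of \<open>x\<close>: otherwise every element of \<open>S\<close> would be
  approximable by power series in \<open>x\<close> alone.
\<close>

lemma reduced_generator:
  obtains y' where "plane_branch S x y'" "\<not> e dvd subdegree y'"
proof -
  define B where "B = range (\<lambda>p. p oo x)"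
  have add: "u + v \<in> B" if "u \<in> B" "v \<in> B" for u v
    using that unfolding B_def by (auto simp flip: fps_compose_add_distrib)
  have xB: "x * u \<in> B" if "u \<in> B" for u
    using that x0 unfolding B_def by (auto simp: fps_X_times_compose)
  have const: "fps_const c \<in> B" for c
    unfolding B_def by (metis fps_const_compose rangeI)
  have multB: "u * v \<in> B" if "u \<in> B" "v \<in> B" for u v
    using that x0 unfolding B_def by (auto simp flip: fps_compose_mult_distrib)
  have "\<exists>b\<in>B. y - b \<noteq> 0 \<and> \<not> e dvd subdegree (y - b)"
  proof (rule ccontr)
    assume no: "\<not> ?thesis"
    have approx: "\<exists>b\<in>B. fps_X ^ N dvd y - b" for N
    proof (rule approximation_or_gap[of B "{k. e dvd k}" N y])
      show "\<exists>b\<in>B. b \<noteq> 0 \<and> subdegree b = k" if k: "k \<in> {k. e dvd k}" for k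
      proof -
        obtain i where "k = e * i" using k by auto
        then have "subdegree (fps_X ^ i oo x) = k" "fps_X ^ i oo x \<noteq> 0"
          using x0 x_nonzero by (auto simp: fps_X_power_subdegree fps_X_power_compose)
        then show ?thesis unfolding B_def by blast
      qed
    qed (use const[of 0] const add multB no in auto)
    show False
    proof (rule not_approximable_by_multiples[OF two_le_order const add xB])
      show "\<exists>v\<in>B. fps_X ^ N dvd y * u - v" if u: "u \<in> B" for N u
      proof -
        obtain b where b: "b \<in> B" "fps_X ^ N dvd y - b" using approx by blast
        then have "fps_X ^ N dvd (y - b) * u" by simp
        then show ?thesis using multB[OF b(1) u] by (auto simp: algebra_simps)
      qed
      show "e dvd subdegree u" if "u \<in> B" for u
        using that x0 unfolding B_def by auto
    qed auto
  qed
  then obtain p where p: "y - (p oo x) \<noteq> 0" "\<not> e dvd subdegree (y - (p oo x))"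
    unfolding B_def by blast
  define y' where "y' = y - (p oo x)"
  have "fps_nth y' 0 = 0"
    using p subdegree_eq_0[of y'] unfolding y'_def by (metis dvd_0_right)
  then have "fps_nth p 0 = 0" using y0 by (simp add: y'_def)
  then have "fps_X ^ 1 dvd p" unfolding X_power_dvd_iff_nth by simp
  then obtain q where "p = fps_X * q" by auto
  then have q: "p oo x = x * (q oo x)" using x0 by (simp add: fps_X_times_compose)
  have "plane_branch S x y'"
  proof
    show "y' \<in> S" unfolding y'_def by (intro diff_mem y_mem series_mem)
    show "\<exists>c s1 s2. s1 \<in> S \<and> s2 \<in> S \<and> s = fps_const c + x * s1 + y' * s2" if s: "s \<in> S" for s
    proof -
      obtain c s1 s2 where s: "s1 \<in> S" "s2 \<in> S" "s = fps_const c + x * s1 + y * s2"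
        using generated[OF s] by blast
      have "s = fps_const c + x * (s1 + (q oo x) * s2) + y' * s2"
        by (simp add: s y'_def q algebra_simps)
      moreover have "s1 + (q oo x) * s2 \<in> S" by (intro add_mem mult_mem series_mem s)
      ultimately show ?thesis using s(2) by blast
    qed
    have "fps_X ^ e dvd x" using X_power_dvd_iff_subdegree by blast
    then show "fps_X ^ e dvd y'" unfolding y'_def q using order_le by simp
  qed (fact const_mem add_mem mult_mem x_mem conductor two_le_order)+
  then show ?thesis using that p unfolding y'_def by blast
qed

end

locale reduced_branch = plane_branch +
  assumes not_dvd: "\<not> subdegree x dvd subdegree y"
begin

abbreviation "m \<equiv> subdegree y"

lemma y_nonzero: "y \<noteq> 0"
  using not_dvd by auto

lemma e_less_m: "e < m"
  using order_le y_nonzero not_dvd unfolding X_power_dvd_iff_subdegree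
  by (metis dvd_refl le_neq_implies_less)

lemma subdegree_series_dvd: "e dvd subdegree (p oo x)"
  using x0 by simp

text \<open>
  Division of a power series in \<open>x\<close>, \<open>y\<close> by \<open>y\<close>.
\<close>

lemma normal_form:
  assumes "s \<in> S"
  obtains p g where "g \<in> S" "s = (p oo x) + y * g"
proof -
  obtain C where C: "\<And>g. fps_X ^ C dvd g \<Longrightarrow> g \<in> S" using conductor by blast
  define T where "T = {(p oo x) + y * g | p g. g \<in> S}"
  have TI: "(p oo x) + y * g \<in> T" if "g \<in> S" for p g using that unfolding T_def by blast
  have "S \<subseteq> T"
  proof (rule subset_of_module_closed[OF generated x0 y0, where N = "m + C"])
    show "fps_const c \<in> T" for c using TI[OF zero_mem, of "fps_const c"] by simp
    show "u + v \<in> T" if uv: "u \<in> T" "v \<in> T" for u v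
    proof -
      obtain p g q h where "u = (p oo x) + y * g" "v = (q oo x) + y * h" "g \<in> S" "h \<in> S"
        using uv unfolding T_def by blast
      then show ?thesis using TI[of "g + h" "p + q"] add_mem
        by (simp add: fps_compose_add_distrib algebra_simps)
    qed
    show "x * u \<in> T" if u: "u \<in> T" for u
    proof -
      obtain p g where "u = (p oo x) + y * g" "g \<in> S" using u unfolding T_def by blast
      moreover from this have "x * u = ((fps_X * p) oo x) + y * (x * g)"
        using fps_X_times_compose[OF x0, of p] by (simp add: algebra_simps)
      ultimately show ?thesis using TI mult_mem[OF x_mem] by metis
    qed
    show "y * u \<in> T" if u: "u \<in> T" for u
    proof -
      have "u \<in> S" using u add_mem mult_mem y_mem series_mem unfolding T_def by auto
      then show ?thesis using TI[of u 0] by simp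
    qed
    show "g \<in> T" if g: "fps_X ^ (m + C) dvd g" for g
    proof -
      obtain k where k: "g = fps_X ^ (m + C) * k" using g ..
      have "y dvd fps_X ^ m" using y_nonzero by (simp add: fps_dvd_iff fps_X_power_subdegree)
      then obtain u where u: "fps_X ^ m = y * u" ..
      have "g = y * (fps_X ^ C * (u * k))" by (simp add: k u power_add algebra_simps)
      moreover have "fps_X ^ C * (u * k) \<in> S" by (rule C) simp
      ultimately show ?thesis using TI[of _ 0] by simp
    qed
  qed
  then show ?thesis using that assms unfolding T_def by blast
qed

text \<open>
  In the normal form \<open>p(x) + y g\<close> the order of the first summand is a multiple of \<open>e\<close>, whereas the
  second has order \<open>m\<close> if \<open>g\<close> is a unit and at least \<open>m + e\<close> otherwise.
\<close>

lemma order_cases: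
  assumes "s \<in> S" "s \<noteq> 0"
  shows "e dvd subdegree s \<or> subdegree s = m \<or> m + e \<le> subdegree s"
proof -
  obtain p g where g: "g \<in> S" and s: "s = (p oo x) + y * g" using normal_form[OF assms(1)] .
  have nz: "(p oo x) + y * g \<noteq> 0" using s assms(2) by simp
  have yg: "subdegree (y * g) = m \<or> m + e \<le> subdegree (y * g)" if "y * g \<noteq> 0"
    using nonunit_subdegree_ge[OF g] that y_nonzero by auto
  from nz show ?thesis
  proof (cases rule: subdegree_add_cases)
    case 1 then show ?thesis using subdegree_series_dvd s by metis
  next
    case 2 then show ?thesis using yg s by metis
  next
    case 3
    have "subdegree (y * g) \<noteq> m" using 3 not_dvd subdegree_series_dvd by metis
    then have "m + e \<le> subdegree (y * g)" using yg[OF 3(2)] by blast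
    then show ?thesis unfolding s using 3(3,4) by linarith
  qed
qed

text \<open>
  This set contains the square of the maximal ideal of \<open>S\<close>; as \<open>g\<close> is a nonunit, it still has no
  element of order \<open>m\<close>.
\<close>

definition square_like :: "'a fps set" where
  "square_like = {(p oo x) + y * g | p g. g \<in> S \<and> fps_nth g 0 = 0}"

lemma square_like_add: "u \<in> square_like \<Longrightarrow> v \<in> square_like \<Longrightarrow> u + v \<in> square_like"
proof -
  assume "u \<in> square_like" "v \<in> square_like"
  then obtain p g q h where "u = (p oo x) + y * g" "v = (q oo x) + y * h" "g \<in> S" "h \<in> S"
      "fps_nth g 0 = 0" "fps_nth h 0 = 0" unfolding square_like_def by blast
  moreover from this have "u + v = ((p + q) oo x) + y * (g + h)"
    by (simp add: fps_compose_add_distrib algebra_simps)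
  moreover have "g + h \<in> S" "fps_nth (g + h) 0 = 0" using calculation add_mem by auto
  ultimately show ?thesis unfolding square_like_def by blast
qed

lemma product_square_like:
  assumes "u \<in> S" "v \<in> S" "fps_nth u 0 = 0" "fps_nth v 0 = 0"
  shows "u * v \<in> square_like"
proof -
  obtain p g where g: "g \<in> S" "u = (p oo x) + y * g" using normal_form[OF assms(1)] .
  obtain q h where h: "h \<in> S" "v = (q oo x) + y * h" using normal_form[OF assms(2)] .
  have "u * v = ((p * q) oo x) + y * (g * v + (p oo x) * h)"
    by (simp add: g h fps_compose_mult_distrib[OF x0] algebra_simps)
  moreover have "g * v + (p oo x) * h \<in> S"
    by (intro add_mem mult_mem series_mem g h assms)
  moreover have "fps_nth (p oo x) 0 = 0" using g assms y0 by simp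
  then have "fps_nth (g * v + (p oo x) * h) 0 = 0" using assms by simp
  ultimately show ?thesis unfolding square_like_def by blast
qed

lemma square_like_order:
  assumes "u \<in> square_like" "u \<noteq> 0"
  shows "subdegree u \<noteq> m"
proof
  assume um: "subdegree u = m"
  obtain p g where g: "g \<in> S" "fps_nth g 0 = 0" and u: "u = (p oo x) + y * g"
    using assms unfolding square_like_def by blast
  have yg: "m < subdegree (y * g)" if "y * g \<noteq> 0"
  proof -
    have "g \<noteq> 0" using that by auto
    then have "subdegree g > 0" using g(2) by (metis nth_subdegree_nonzero gr0I)
    then show ?thesis using subdegree_mult[OF y_nonzero \<open>g \<noteq> 0\<close>] by linarith
  qed
  have nz: "(p oo x) + y * g \<noteq> 0" using u assms(2) by simp
  then show False
  proof (cases rule: subdegree_add_cases)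
    case 1 then show ?thesis using um u subdegree_series_dvd not_dvd by metis
  next
    case 2 then show ?thesis using um u yg by simp
  next
    case 3 then show ?thesis using um u yg by simp
  qed
qed

end

section \<open>Derivations of low order\<close>

context reduced_branch
begin

text \<open>
  Write \<open>r\<close> for the order of \<open>a\<close> and \<open>D = a d/dt\<close>. Since \<open>D\<close> adds \<open>r - 1\<close> to the order of every
  nonzero nonunit, the orders \<open>e + r - 1\<close> and \<open>m + r - 1\<close> must both occur in \<open>S\<close>. For \<open>r \<noteq> 1\<close> the first is not a
  multiple of \<open>e\<close> and is less than \<open>2 e\<close>, so it is \<open>m\<close>; the second is then
  \<open>2 m - e\<close>, strictly between \<open>m\<close> and \<open>m + e\<close>, so it is a multiple of \<open>e\<close>, which leaves
  only \<open>2 m = 3 e\<close>.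
\<close>

lemma derivation_order_cases:
  assumes "a \<noteq> 0" and stable: "\<And>s. s \<in> S \<Longrightarrow> a * fps_deriv s \<in> S" and le: "subdegree a \<le> e"
  shows "subdegree a = 1 \<or> (\<exists>h>0. subdegree a = h + 1 \<and> e = 2 * h \<and> m = 3 * h)"
proof (cases "subdegree a = 1")
  case False
  define r where "r = subdegree a"
  have e2: "2 \<le> e" by (rule two_le_order)
  have em: "e < m" by (rule e_less_m)
  have Dx: "a * fps_deriv x \<in> S" "a * fps_deriv x \<noteq> 0" "subdegree (a * fps_deriv x) = r + e - 1"
    using stable[OF x_mem] subdegree_derivation[OF assms(1) x_nonzero x0] by (auto simp: r_def)
  have Dy: "a * fps_deriv y \<in> S" "a * fps_deriv y \<noteq> 0" "subdegree (a * fps_deriv y) = r + m - 1"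
    using stable[OF y_mem] subdegree_derivation[OF assms(1) y_nonzero y0] by (auto simp: r_def)
  have "\<not> e dvd r + e - 1"
  proof
    assume "e dvd r + e - 1"
    then obtain i where i: "r + e - 1 = e * i" ..
    have "0 < r + e - 1" "r + e - 1 < e * 2" "r + e - 1 \<noteq> e"
      using e2 le False by (auto simp: r_def)
    then have "0 < i" "i < 2" "i \<noteq> 1" unfolding i by auto
    then show False by linarith
  qed
  then have m: "r + e - 1 = m"
    using order_cases[OF Dx(1,2)] em le e2 unfolding Dx(3) r_def by linarith
  define h where "h = r - 1"
  have h: "r = h + 1" "m = e + h" "0 < h" "h < e"
    using m em le e2 by (auto simp: h_def r_def)
  have "e dvd r + m - 1"
    using order_cases[OF Dy(1,2)] h unfolding Dy(3) by auto
  moreover have "r + m - 1 = e + 2 * h" using h by simp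
  ultimately have "e dvd 2 * h" by (metis dvd_add_right_iff dvd_refl)
  then obtain i where i: "2 * h = e * i" ..
  have "0 < e * i" "e * i < e * 2" using h unfolding i[symmetric] by auto
  then have "i = 1" by auto
  then show ?thesis using h i by (intro disjI2 exI[of _ h]) (auto simp: r_def)
qed simp

lemma two_generator_order:
  assumes "h dvd e" "h dvd m" and nz: "(p oo x) + (q oo x) * y \<noteq> 0"
  shows "h dvd subdegree ((p oo x) + (q oo x) * y)"
proof -
  have hx: "h dvd subdegree (k oo x)" for k
    using subdegree_series_dvd assms(1) by (metis dvd_trans)
  from nz show ?thesis
  proof (cases rule: subdegree_add_cases)
    case 1 then show ?thesis using hx by metis
  next
    case 2
    then have "subdegree ((q oo x) * y) = subdegree (q oo x) + m" by (auto simp: y_nonzero)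
    then show ?thesis using 2(2) hx assms(2) by (metis dvd_add)
  next
    case 3
    then have "subdegree (p oo x) = subdegree (q oo x) + m" by (auto simp: y_nonzero)
    then have "e dvd m" using subdegree_series_dvd by (metis dvd_add_right_iff)
    then show ?thesis using not_dvd by blast
  qed
qed

text \<open>
  The elements of \<open>k[[x]] + k[[x]] y\<close> realize every multiple of \<open>h\<close> except \<open>h\<close> itself as an order.
  Reducing \<open>y^2\<close>, the first monomial missing from this module, must therefore stop at an order not
  divisible by \<open>h\<close>: if \<open>y^2\<close> were approximable, so would be all of \<open>S\<close>, which has orders not
  divisible by \<open>h\<close>.
\<close>

lemma third_generator:
  assumes "2 \<le> h" and e: "e = 2 * h" and m: "m = 3 * h"
  obtains w p q where "w \<in> S" "w \<noteq> 0" "\<not> h dvd subdegree w" "y ^ 2 = (p oo x) + (q oo x) * y + w"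
proof -
  define B where "B = {(p oo x) + (q oo x) * y | p q. True}"
  have BI: "(p oo x) + (q oo x) * y \<in> B" for p q unfolding B_def by blast
  have const: "fps_const c \<in> B" for c using BI[of "fps_const c" 0] by simp
  have add: "u + v \<in> B" if u: "u \<in> B" and v: "v \<in> B" for u v
  proof -
    obtain p q where "u = (p oo x) + (q oo x) * y" using u unfolding B_def by blast
    moreover obtain p' q' where "v = (p' oo x) + (q' oo x) * y" using v unfolding B_def by blast
    ultimately have "u + v = ((p + p') oo x) + ((q + q') oo x) * y"
      by (simp add: fps_compose_add_distrib algebra_simps)
    then show ?thesis using BI by metis
  qed
  have seriesB: "(l oo x) * u \<in> B" if u: "u \<in> B" for l u
  proof -
    obtain p q where "u = (p oo x) + (q oo x) * y" using u unfolding B_def by blast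
    then have "(l oo x) * u = ((l * p) oo x) + ((l * q) oo x) * y"
      by (simp add: fps_compose_mult_distrib[OF x0] algebra_simps)
    then show ?thesis using BI by metis
  qed
  have orders: "h dvd subdegree u" if u: "u \<in> B" "u \<noteq> 0" for u
  proof -
    obtain p q where "u = (p oo x) + (q oo x) * y" using u unfolding B_def by blast
    then show ?thesis using two_generator_order[of h p q] u(2) e m by simp
  qed
  have "\<exists>b\<in>B. y ^ 2 - b \<noteq> 0 \<and> subdegree (y ^ 2 - b) \<notin> {h * k | k. k \<noteq> 1}"
  proof (rule ccontr)
    assume no: "\<not> ?thesis"
    have approx: "\<exists>b\<in>B. fps_X ^ N dvd y ^ 2 - b" for N
    proof (rule approximation_or_gap[of B "{h * k | k. k \<noteq> 1}" N "y ^ 2"])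
      show "0 \<in> B" using const[of 0] by simp
      show "u + v \<in> B" if "u \<in> B" "v \<in> B" for u v using add that .
      show "fps_const c * u \<in> B" if "u \<in> B" for c u using seriesB[OF that, of "fps_const c"] by simp
      show "\<exists>b\<in>B. fps_X ^ N dvd y ^ 2 - b" if "b \<in> B" "fps_X ^ N dvd y ^ 2 - b" for b
        using that by blast
      show "\<exists>b\<in>B. fps_X ^ N dvd y ^ 2 - b"
        if "b \<in> B" "y ^ 2 - b \<noteq> 0" "subdegree (y ^ 2 - b) \<notin> {h * k | k. k \<noteq> 1}" for b
        using that no by blast
      show "\<exists>b\<in>B. b \<noteq> 0 \<and> subdegree b = k" if kk: "k \<in> {h * k | k. k \<noteq> 1}" for k
      proof -
        obtain l where l: "k = h * l" "l \<noteq> 1" using kk by auto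
        show ?thesis
        proof (cases "even l")
          case True
          then obtain i where "l = 2 * i" ..
          then have "subdegree (x ^ i) = k" using l e by simp
          moreover have "x ^ i \<noteq> 0" using x_nonzero by simp
          moreover have "x ^ i \<in> B" using BI[of "fps_X ^ i" 0] x0 by (simp add: fps_X_power_compose)
          ultimately show ?thesis by blast
        next
          case False
          then have "l \<ge> 3" using l(2) by (metis One_nat_def even_zero less_2_cases linorder_not_le
                numeral_2_eq_2 numeral_3_eq_3 less_Suc_eq even_numeral)
          then obtain i where "l = 2 * i + 3" using False
            by (metis add.commute even_add le_add_diff_inverse2 odd_numeral dvdE)
          then have "subdegree (x ^ i * y) = k" using l e m x_nonzero y_nonzero by (simp add: algebra_simps)
          moreover have "x ^ i * y \<noteq> 0" using x_nonzero y_nonzero by simp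
          moreover have "x ^ i * y \<in> B"
            using BI[of 0 "fps_X ^ i"] x0 by (simp add: fps_X_power_compose)
          ultimately show ?thesis by blast
        qed
      qed
    qed
    show False
    proof (rule not_approximable_by_multiples[OF assms(1) const add])
      show "x * u \<in> B" if "u \<in> B" for u using seriesB[OF that, of fps_X] x0 by simp
      show "\<exists>v\<in>B. fps_X ^ N dvd y * u - v" if u: "u \<in> B" for N u
      proof -
        obtain p q where pq: "u = (p oo x) + (q oo x) * y" using u unfolding B_def by blast
        obtain b where b: "b \<in> B" "fps_X ^ N dvd y ^ 2 - b" using approx by blast
        have "(p oo x) * y + (q oo x) * b \<in> B"
          using add[OF _ seriesB[OF b(1)]] BI[of 0 p] by simp
        moreover have "y * u - ((p oo x) * y + (q oo x) * b) = (q oo x) * (y ^ 2 - b)"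
          by (simp add: pq power2_eq_square algebra_simps)
        ultimately show ?thesis using b(2) by (metis dvd_mult)
      qed
      show "h dvd subdegree u" if "u \<in> B" "u \<noteq> 0" for u using orders that .
    qed
  qed
  then obtain p q where pq: "y ^ 2 - ((p oo x) + (q oo x) * y) \<noteq> 0"
      "subdegree (y ^ 2 - ((p oo x) + (q oo x) * y)) \<notin> {h * k | k. k \<noteq> 1}"
    unfolding B_def by blast
  define w where "w = y ^ 2 - ((p oo x) + (q oo x) * y)"
  have w: "w \<in> S" unfolding w_def by (intro diff_mem add_mem mult_mem power_mem series_mem y_mem)
  have "\<not> h dvd subdegree w"
  proof
    assume "h dvd subdegree w"
    then have "subdegree w = h" using pq(2) unfolding w_def[symmetric] by (auto elim!: dvdE)
    then show False using nonunit_subdegree_ge[OF w] pq(1) assms(1) e unfolding w_def[symmetric] by linarith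
  qed
  moreover have "y ^ 2 = (p oo x) + (q oo x) * y + w" by (simp add: w_def)
  ultimately show ?thesis using that w pq(1) w_def by blast
qed

text \<open>
  With \<open>w\<close> from \<open>third_generator\<close>, \<open>S = k[[x]] + k[[x]] y + w S\<close>. The first two summands only give
  multiples of \<open>h\<close>, and \<open>w S\<close> only gives the order \<open>s\<close> of \<open>w\<close> or orders \<open>\<ge> s + 2 h\<close>. So \<open>s + h\<close> is
  not an order of \<open>S\<close>, although it is the order of \<open>a w'\<close>.
\<close>

lemma no_derivation_beyond_cusp:
  assumes "a \<noteq> 0" and stable: "\<And>s. s \<in> S \<Longrightarrow> a * fps_deriv s \<in> S"
    and h2: "2 \<le> h" and e: "e = 2 * h" and m: "m = 3 * h" and a: "subdegree a = h + 1"
  shows False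
proof -
  obtain w p q where w: "w \<in> S" "w \<noteq> 0" "\<not> h dvd subdegree w"
      and y2: "y ^ 2 = (p oo x) + (q oo x) * y + w"
    using third_generator[OF h2 e m] .
  obtain C where C: "\<And>g. fps_X ^ C dvd g \<Longrightarrow> g \<in> S" using conductor by blast
  define T where "T = {(k oo x) + (l oo x) * y + w * g | k l g. g \<in> S}"
  have TI: "(k oo x) + (l oo x) * y + w * g \<in> T" if "g \<in> S" for k l g
    using that unfolding T_def by blast
  have "S \<subseteq> T"
  proof (rule subset_of_module_closed[OF generated x0 y0, where N = "subdegree w + C"])
    show "fps_const c \<in> T" for c using TI[OF zero_mem, of "fps_const c" 0] by simp
    show "u + v \<in> T" if u: "u \<in> T" and v: "v \<in> T" for u v
    proof -
      obtain k l g where 1: "u = (k oo x) + (l oo x) * y + w * g" "g \<in> S"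
        using u unfolding T_def by blast
      obtain k' l' g' where 2: "v = (k' oo x) + (l' oo x) * y + w * g'" "g' \<in> S"
        using v unfolding T_def by blast
      have "u + v = ((k + k') oo x) + ((l + l') oo x) * y + w * (g + g')"
        by (simp add: 1 2 fps_compose_add_distrib algebra_simps)
      then show ?thesis using TI[OF add_mem[OF 1(2) 2(2)]] by simp
    qed
    show "x * u \<in> T" if u: "u \<in> T" for u
    proof -
      obtain k l g where 1: "u = (k oo x) + (l oo x) * y + w * g" "g \<in> S"
        using u unfolding T_def by blast
      have "x * u = ((fps_X * k) oo x) + ((fps_X * l) oo x) * y + w * (x * g)"
        by (simp add: 1 fps_X_times_compose[OF x0, symmetric] algebra_simps)
      then show ?thesis using TI[OF mult_mem[OF x_mem 1(2)]] by simp
    qed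
    show "y * u \<in> T" if u: "u \<in> T" for u
    proof -
      obtain k l g where 1: "u = (k oo x) + (l oo x) * y + w * g" "g \<in> S"
        using u unfolding T_def by blast
      have "y * u = (k oo x) * y + (l oo x) * y ^ 2 + w * (y * g)"
        by (simp add: 1 power2_eq_square algebra_simps)
      also have "\<dots> = ((l * p) oo x) + ((k + l * q) oo x) * y + w * ((l oo x) + y * g)"
        by (simp add: y2 fps_compose_add_distrib fps_compose_mult_distrib[OF x0] algebra_simps)
      finally show ?thesis
        using TI[OF add_mem[OF series_mem mult_mem[OF y_mem 1(2)]]] by simp
    qed
    show "g \<in> T" if g: "fps_X ^ (subdegree w + C) dvd g" for g
    proof -
      obtain k where k: "g = fps_X ^ (subdegree w + C) * k" using g ..
      have "w dvd fps_X ^ subdegree w" using w by (simp add: fps_dvd_iff fps_X_power_subdegree)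
      then obtain u where u: "fps_X ^ subdegree w = w * u" ..
      have "g = w * (fps_X ^ C * (u * k))" by (simp add: k u power_add algebra_simps)
      moreover have "fps_X ^ C * (u * k) \<in> S" by (rule C) simp
      ultimately show ?thesis using TI[of _ 0 0] by simp
    qed
  qed
  define s where "s = subdegree w"
  have w0: "fps_nth w 0 = 0" using w by (metis dvd_0_right subdegree_eq_0)
  have Dw: "a * fps_deriv w \<in> S" "a * fps_deriv w \<noteq> 0" "subdegree (a * fps_deriv w) = s + h"
    using stable[OF w(1)] subdegree_derivation[OF assms(1) w(2) w0] a by (auto simp: s_def)
  obtain k l g where g: "g \<in> S" and D: "a * fps_deriv w = ((k oo x) + (l oo x) * y) + w * g"
    using Dw(1) \<open>S \<subseteq> T\<close> unfolding T_def by blast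
  define z where "z = (k oo x) + (l oo x) * y"
  have zord: "h dvd subdegree z" if "z \<noteq> 0"
    using two_generator_order[of h k l] that e m unfolding z_def by simp
  have gord: "g \<noteq> 0 \<Longrightarrow> subdegree g = 0 \<or> 2 * h \<le> subdegree g"
    using nonunit_subdegree_ge[OF g] e by simp
  have wg: "subdegree (w * g) = s \<or> s + 2 * h \<le> subdegree (w * g)" if "w * g \<noteq> 0"
    using that gord w(2) by (auto simp: s_def)
  have ndvd: "\<not> h dvd s" "\<not> h dvd s + h" using w(3) by (auto simp: s_def)
  have nz: "z + w * g \<noteq> 0" and sd: "subdegree (z + w * g) = s + h"
    using Dw D unfolding z_def by auto
  from nz show False
  proof (cases rule: subdegree_add_cases)
    case 1 then show ?thesis using sd zord ndvd by metis
  next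
    case 2 then show ?thesis using sd wg h2 by linarith
  next
    case 3
    then have "subdegree (w * g) \<noteq> s" using zord ndvd by metis
    then show ?thesis using 3 wg sd h2 by linarith
  qed
qed

text \<open>
  The orders \<open>2\<close> and \<open>3\<close> generate all integers \<open>\<ge> 2\<close>, so that reduction by elements of \<open>S\<close> never gets
  stuck before it reaches the conductor. In particular any uniformizer has its square and its cube
  in \<open>S\<close>.
\<close>

lemma all_orders_of_cusp:
  assumes "e = 2" "m = 3" "2 \<le> k"
  shows "fps_X ^ k \<in> S"
proof -
  obtain C where C: "\<And>g. fps_X ^ C dvd g \<Longrightarrow> g \<in> S" using conductor by blast
  define B where "B = {s \<in> S. fps_nth s 0 = 0}"
  have BX: "fps_X ^ 2 dvd b" if "b \<in> B" for b
    using nonunit_order_ge that assms(1) unfolding B_def by auto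
  show ?thesis
  proof (rule approximation_or_gap[of B "{2..}" C "fps_X ^ k"])
    show "\<exists>b\<in>B. b \<noteq> 0 \<and> subdegree b = l" if "l \<in> {2..}" for l
    proof (cases "even l")
      case True
      then obtain i where i: "l = 2 * i" ..
      have "x ^ i \<noteq> 0" "subdegree (x ^ i) = l" using x_nonzero assms i by auto
      moreover have "x ^ i \<in> B" unfolding B_def using power_mem[OF x_mem] x0 i that
        by (auto simp: fps_power_zeroth)
      ultimately show ?thesis by blast
    next
      case False
      then have "3 \<le> l" using that by (metis atLeast_iff le_antisym not_less_eq_eq numeral_2_eq_2
            numeral_3_eq_3 even_numeral)
      then obtain i where i: "l = 2 * i + 3" using False
        by (metis add.commute even_add le_add_diff_inverse2 odd_numeral dvdE)
      have "x ^ i * y \<noteq> 0" "subdegree (x ^ i * y) = l" using x_nonzero y_nonzero assms i by auto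
      moreover have "x ^ i * y \<in> B" unfolding B_def
        using mult_mem[OF power_mem[OF x_mem] y_mem] y0 by auto
      ultimately show ?thesis by blast
    qed
    show "fps_X ^ k \<in> S" if b: "b \<in> B" "fps_X ^ C dvd fps_X ^ k - b" for b
      using add_mem[OF _ C[OF b(2)], of b] b(1) unfolding B_def by simp
    show "fps_X ^ k \<in> S" if b: "b \<in> B" "fps_X ^ k - b \<noteq> 0" "subdegree (fps_X ^ k - b) \<notin> {2..}" for b
    proof -
      have "fps_X ^ 2 dvd fps_X ^ k - b" using BX[OF b(1)] assms(3) by (simp add: le_imp_power_dvd)
      then show ?thesis using b(2,3) unfolding X_power_dvd_iff_subdegree by simp
    qed
  qed (auto simp: B_def zero_mem add_mem mult_mem const_mem)
qed

end

text \<open>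
  A vector field with a simple zero is linear in a suitable uniformizer: writing \<open>\<tau> = t exp(g)\<close> and
  \<open>a = t b\<close>, the equation \<open>a \<tau>' = c \<tau>\<close> becomes \<open>b (1 + t g') = c\<close>, which is solved by integration.
\<close>

lemma linearizing_uniformizer:
  fixes a :: "'a::field_char_0 fps"
  assumes "subdegree a = 1"
  obtains \<tau> where "subdegree \<tau> = 1" "a * fps_deriv \<tau> = fps_const (fps_nth a 1) * \<tau>"
proof -
  define c where "c = fps_nth a 1"
  have a_nz: "a \<noteq> 0" using assms by auto
  have c: "c \<noteq> 0" using nth_subdegree_nonzero[OF a_nz] assms by (simp add: c_def)
  have "fps_X ^ 1 dvd a" using X_power_dvd_iff_subdegree[of 1 a] assms by simp
  then obtain b where b: "a = fps_X * b" by auto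
  have b0: "fps_nth b 0 = c" by (simp add: c_def b)
  have "fps_X ^ 1 dvd fps_const c * inverse b - 1"
    unfolding X_power_dvd_iff_nth using b0 c by simp
  then obtain q where q: "fps_const c * inverse b - 1 = fps_X * q" by auto
  define g where "g = fps_integral0 q"
  have g: "fps_deriv g = q" "fps_nth g 0 = 0"
    by (simp_all add: g_def fps_deriv_fps_integral)
  define E where "E = fps_exp 1 oo g"
  have E0: "fps_nth E 0 = 1" by (simp add: E_def)
  have dE: "fps_deriv E = E * q"
    unfolding E_def by (simp add: fps_compose_deriv[OF g(2)] g(1))
  define \<tau> where "\<tau> = fps_X * E"
  have "E \<noteq> 0" using E0 by auto
  have "subdegree E = 0" using E0 by simp
  then have "subdegree \<tau> = 1" using \<open>E \<noteq> 0\<close> by (simp add: \<tau>_def)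
  moreover have "a * fps_deriv \<tau> = fps_const (fps_nth a 1) * \<tau>"
  proof -
    have "a * fps_deriv \<tau> = fps_X * E * (b * (1 + fps_X * q))"
      by (simp add: \<tau>_def b dE algebra_simps)
    also have "b * (1 + fps_X * q) = fps_const c * (b * inverse b)"
      by (simp flip: q)
    also have "b * inverse b = 1" using b0 c by (simp add: inverse_mult_eq_1')
    finally show ?thesis by (simp add: \<tau>_def c_def)
  qed
  ultimately show ?thesis using that by blast
qed

context plane_branch
begin

text \<open>
  In terms of \<open>\<tau>\<close> the operator \<open>D = a d/dt\<close> is \<open>c \<tau> d/d\<tau>\<close>, with eigenvectors \<open>\<tau>^N\<close> for the eigenvalues
  \<open>N c\<close>. Applying \<open>D - N c\<close> for \<open>N = n + 1, n + 2, ...\<close> to an element of order \<open>n\<close> removes its higher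
  terms one after the other and only rescales its leading term; past the conductor the rest is in
  \<open>S\<close> anyway.
\<close>

lemma eigenvector_mem:
  assumes a: "subdegree a = 1" and stable: "\<And>s. s \<in> S \<Longrightarrow> a * fps_deriv s \<in> S"
    and \<tau>: "subdegree \<tau> = 1" "a * fps_deriv \<tau> = fps_const (fps_nth a 1) * \<tau>"
    and s: "s \<in> S" "s \<noteq> 0" "subdegree s = n"
  shows "\<tau> ^ n \<in> S"
proof -
  define c where "c = fps_nth a 1"
  have "a \<noteq> 0" using a by auto
  then have c: "c \<noteq> 0" using nth_subdegree_nonzero a by (metis c_def)
  have "fps_X ^ 1 dvd a" using X_power_dvd_iff_subdegree[of 1 a] a by simp
  then obtain b where b: "a = fps_X * b" by auto
  have b0: "fps_nth b 0 = c" by (simp add: c_def b)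
  have "fps_X ^ 1 dvd b - fps_const c" unfolding X_power_dvd_iff_nth by (simp add: b0)
  then obtain b' where b': "b - fps_const c = fps_X * b'" by auto
  have \<tau>_nz: "\<tau> \<noteq> 0" using \<tau>(1) by auto
  have eigen: "a * fps_deriv (\<tau> ^ n) = fps_const (of_nat n * c) * \<tau> ^ n"
  proof (cases n)
    case (Suc k)
    have "a * fps_deriv (\<tau> ^ n) = fps_const (of_nat n) * (a * fps_deriv \<tau>) * \<tau> ^ k"
      unfolding fps_deriv_power Suc by (simp add: algebra_simps)
    also have "\<dots> = (fps_const (of_nat n) * fps_const c) * (\<tau> * \<tau> ^ k)"
      unfolding \<tau>(2) c_def[symmetric] by (simp only: mult_ac)
    finally show ?thesis by (simp only: fps_const_mult power_Suc[symmetric] Suc[symmetric])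
  qed simp
  have "\<exists>h\<in>S. \<exists>\<alpha>. \<alpha> \<noteq> 0 \<and> fps_X ^ N dvd h - fps_const \<alpha> * \<tau> ^ n" if "Suc n \<le> N" for N
    using that
  proof (induction N rule: nat_induct_at_least)
    case base
    have \<tau>n: "subdegree (\<tau> ^ n) = n" using \<tau> by simp
    then have t: "fps_nth (\<tau> ^ n) n \<noteq> 0" using \<tau>_nz by (metis nth_subdegree_nonzero power_not_zero)
    have sn: "fps_nth s n \<noteq> 0" using s by (metis nth_subdegree_nonzero)
    define \<alpha> where "\<alpha> = fps_nth s n / fps_nth (\<tau> ^ n) n"
    have "fps_nth (s - fps_const \<alpha> * \<tau> ^ n) i = 0" if "i < Suc n" for i
    proof (cases "i = n")
      case True then show ?thesis using t by (simp add: \<alpha>_def)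
    next
      case False
      then have i: "i < n" using that by simp
      have "fps_nth s i = 0" "fps_nth (\<tau> ^ n) i = 0"
        using i s(3) \<tau>n by (metis nth_less_subdegree_zero)+
      then show ?thesis by simp
    qed
    then have "fps_X ^ Suc n dvd s - fps_const \<alpha> * \<tau> ^ n" unfolding X_power_dvd_iff_nth by blast
    moreover have "\<alpha> \<noteq> 0" using t sn by (simp add: \<alpha>_def)
    ultimately show ?case using s(1) by blast
  next
    case (Suc N)
    then obtain h \<alpha> where h: "h \<in> S" "\<alpha> \<noteq> 0" "fps_X ^ N dvd h - fps_const \<alpha> * \<tau> ^ n" by auto
    obtain k where k: "h - fps_const \<alpha> * \<tau> ^ n = fps_X ^ N * k" using h(3) ..
    obtain M where M: "N = Suc M" using Suc by (cases N) auto
    \<comment> \<open>\<open>D - N c\<close> multiplies \<open>\<tau>^n\<close> by \<open>(n - N) c\<close> and kills \<open>t^N\<close> to leading order\<close>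
    define h' where "h' = a * fps_deriv h - fps_const (of_nat N * c) * h"
    define \<beta> where "\<beta> = (of_nat n - of_nat N) * c * \<alpha>"
    have dh: "fps_deriv h = fps_const \<alpha> * fps_deriv (\<tau> ^ n)
        + (fps_const (of_nat N) * fps_X ^ M * k + fps_X ^ N * fps_deriv k)"
    proof -
      have "h = fps_const \<alpha> * \<tau> ^ n + fps_X ^ N * k" using k by (simp add: algebra_simps)
      then have "fps_deriv h = fps_const \<alpha> * fps_deriv (\<tau> ^ n) + fps_deriv (fps_X ^ N * k)"
        by (simp add: fps_deriv_power)
      also have "fps_deriv (fps_X ^ N * k) = fps_const (of_nat N) * fps_X ^ M * k + fps_X ^ N * fps_deriv k"
      proof -
        have "fps_deriv (fps_X ^ N :: 'a fps) = fps_const (of_nat N) * fps_X ^ M"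
          unfolding fps_deriv_power M by simp
        then show ?thesis by (simp only: fps_deriv_mult) (simp add: algebra_simps)
      qed
      finally show ?thesis .
    qed
    have "h' - fps_const \<beta> * \<tau> ^ n = fps_X ^ Suc N * (fps_const (of_nat N) * b' * k + b * fps_deriv k)"
    proof -
      have hk: "h = fps_const \<alpha> * \<tau> ^ n + fps_X ^ N * k" using k by (simp add: algebra_simps)
      have "a * fps_deriv h = fps_const \<alpha> * (a * fps_deriv (\<tau> ^ n))
          + a * (fps_const (of_nat N) * fps_X ^ M * k + fps_X ^ N * fps_deriv k)"
        unfolding dh by (simp only: ring_distribs mult_ac)
      also have "a * (fps_const (of_nat N) * fps_X ^ M * k + fps_X ^ N * fps_deriv k)
          = fps_X ^ N * (fps_const (of_nat N) * b * k) + fps_X ^ Suc N * (b * fps_deriv k)"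
        unfolding b M by (simp add: algebra_simps)
      finally have ah: "a * fps_deriv h = fps_const \<alpha> * (fps_const (of_nat n * c) * \<tau> ^ n)
          + (fps_X ^ N * (fps_const (of_nat N) * b * k) + fps_X ^ Suc N * (b * fps_deriv k))"
        unfolding eigen .
      have bb: "b = fps_const c + fps_X * b'" using b' by (simp add: algebra_simps)
      have \<beta>: "fps_const \<beta> = fps_const \<alpha> * fps_const (of_nat n * c) - fps_const (of_nat N * c) * fps_const \<alpha>"
        unfolding \<beta>_def by (simp add: algebra_simps)
      have Nc: "fps_const (of_nat N * c) = fps_const (of_nat N) * fps_const c" by simp
      define \<nu> where "\<nu> = fps_const (of_nat N :: 'a)"
      define \<kappa> where "\<kappa> = fps_const c"
      have "fps_X ^ N * (\<nu> * b * k) - \<nu> * \<kappa> * (fps_X ^ N * k) = fps_X ^ Suc N * (\<nu> * b' * k)"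
        unfolding bb \<kappa>_def[symmetric] by (simp add: algebra_simps)
      then show ?thesis
        unfolding h'_def ah \<beta> Nc \<nu>_def[symmetric] \<kappa>_def[symmetric] unfolding hk
        by (simp only: ring_distribs) (simp add: algebra_simps)
    qed
    then have "fps_X ^ Suc N dvd h' - fps_const \<beta> * \<tau> ^ n" by simp
    moreover have "\<beta> \<noteq> 0" using c h(2) Suc.hyps by (simp add: \<beta>_def)
    moreover have "h' \<in> S" unfolding h'_def by (intro diff_mem mult_mem const_mem stable h)
    ultimately show ?case by blast
  qed
  moreover obtain C where C: "\<And>g. fps_X ^ C dvd g \<Longrightarrow> g \<in> S" using conductor by blast
  ultimately obtain h \<alpha> where h: "h \<in> S" "\<alpha> \<noteq> 0" "fps_X ^ (C + Suc n) dvd h - fps_const \<alpha> * \<tau> ^ n"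
    by (meson le_add2)
  then have "fps_X ^ C dvd h - fps_const \<alpha> * \<tau> ^ n" by (metis dvd_trans le_add1 le_imp_power_dvd)
  then have "h - (h - fps_const \<alpha> * \<tau> ^ n) \<in> S" by (intro diff_mem h C)
  then have "fps_const \<alpha> * \<tau> ^ n \<in> S" by simp
  then have "fps_const (1 / \<alpha>) * (fps_const \<alpha> * \<tau> ^ n) \<in> S" by (rule mult_mem[OF const_mem])
  moreover have "fps_const (1 / \<alpha>) * fps_const \<alpha> = 1" using h(2) by simp
  then have "fps_const (1 / \<alpha>) * (fps_const \<alpha> * \<tau> ^ n) = \<tau> ^ n"
    by (simp only: mult.assoc[symmetric] mult_1_left)
  ultimately show ?thesis by (simp only:)
qed

end

lemma (in reduced_branch) monomial_generators:
  assumes "a \<noteq> 0" and stable: "\<And>s. s \<in> S \<Longrightarrow> a * fps_deriv s \<in> S" and "subdegree a \<le> e"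
  obtains \<tau> where "subdegree \<tau> = 1" "\<tau> ^ e \<in> S" "\<tau> ^ m \<in> S"
proof -
  consider "subdegree a = 1"
    | h where "0 < h" "subdegree a = h + 1" "e = 2 * h" "m = 3 * h"
    using derivation_order_cases[of a] assms by blast
  then show ?thesis
  proof cases
    case a: 1
    obtain \<tau> where \<tau>: "subdegree \<tau> = 1" "a * fps_deriv \<tau> = fps_const (fps_nth a 1) * \<tau>"
      using linearizing_uniformizer[OF a] .
    have "\<tau> ^ e \<in> S" by (rule eigenvector_mem[OF a _ \<tau> x_mem x_nonzero refl]) (rule stable)
    moreover have "\<tau> ^ m \<in> S" by (rule eigenvector_mem[OF a _ \<tau> y_mem y_nonzero refl]) (rule stable)
    ultimately show ?thesis using that[OF \<tau>(1)] by blast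
  next
    case h: 2
    have "h = 1"
    proof (rule ccontr)
      assume "h \<noteq> 1"
      then have h2: "2 \<le> h" using h(1) by simp
      show False by (rule no_derivation_beyond_cusp[OF assms(1) _ h2 h(3,4,2)]) (rule stable)
    qed
    then show ?thesis using that[of fps_X] all_orders_of_cusp h by simp
  qed
qed

text \<open>
  A common divisor \<open>d\<close> of the exponents would make all of \<open>S\<close> consist of power series in \<open>\<tau>^d\<close>,
  which is incompatible with the conductor.
\<close>

lemma coprime_exponents:
  assumes "plane_branch S (\<tau> ^ i) (\<tau> ^ j)" and \<tau>: "subdegree \<tau> = 1"
  shows "coprime i j"
proof (rule ccontr)
  assume nc: "\<not> coprime i j"
  interpret plane_branch S "\<tau> ^ i" "\<tau> ^ j" by fact
  define d where "d = gcd i j"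
  have i2: "2 \<le> i" using two_le_order \<tau> by simp
  then have "d \<noteq> 0" by (simp add: d_def)
  moreover have "d \<noteq> 1" using nc by (simp add: d_def coprime_iff_gcd_eq_1)
  ultimately have d2: "2 \<le> d" by linarith
  have \<tau>0: "fps_nth \<tau> 0 = 0" by (rule nth_less_subdegree_zero) (simp add: \<tau>)
  have \<tau>d0: "fps_nth (\<tau> ^ d) 0 = 0" using \<tau>0 d2 by (simp add: fps_power_zeroth)
  define T where "T = range (\<lambda>q. q oo \<tau> ^ d)"
  have pow: "\<tau> ^ l * u \<in> T" if l: "d dvd l" and u: "u \<in> T" for l u
  proof -
    obtain k where k: "l = d * k" using l ..
    obtain q where "u = q oo \<tau> ^ d" using u unfolding T_def by blast
    then have "\<tau> ^ l * u = (fps_X ^ k * q) oo \<tau> ^ d"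
      by (simp add: k power_mult fps_compose_mult_distrib[OF \<tau>d0] fps_X_power_compose[OF \<tau>d0])
    then show ?thesis unfolding T_def by blast
  qed
  show False
  proof (rule not_approximable_by_multiples[OF d2, of T])
    show "fps_const c \<in> T" for c unfolding T_def by (metis fps_const_compose rangeI)
    show "u + v \<in> T" if "u \<in> T" "v \<in> T" for u v
      using that unfolding T_def by (auto simp flip: fps_compose_add_distrib)
    show "\<tau> ^ i * u \<in> T" if "u \<in> T" for u using pow that by (simp add: d_def)
    show "\<exists>v\<in>T. fps_X ^ N dvd \<tau> ^ j * u - v" if "u \<in> T" for N u
      using pow[OF _ that, of j] by (intro bexI[of _ "\<tau> ^ j * u"]) (auto simp: d_def)
    show "d dvd subdegree u" if "u \<in> T" for u
      using that \<tau>d0 \<tau> unfolding T_def by auto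
  qed
qed

section \<open>The filtration of k[[X,Y]] by order\<close>

text \<open>
  The \<open>N\<close>-th power of the maximal ideal, in terms of coefficients.
\<close>

definition vanishing_ideal :: "nat \<Rightarrow> 'a::field fps fps set" where
  "vanishing_ideal N = {g. \<forall>i j. i + j < N \<longrightarrow> fps_nth (fps_nth g j) i = 0}"

lemma vanishing_idealD: "g \<in> vanishing_ideal N \<Longrightarrow> i + j < N \<Longrightarrow> fps_nth (fps_nth g j) i = 0"
  by (simp add: vanishing_ideal_def)

lemma vanishing_ideal_0: "vanishing_ideal 0 = UNIV"
  by (simp add: vanishing_ideal_def)

lemma vanishing_ideal_1 [simp]: "g \<in> vanishing_ideal (Suc 0) \<longleftrightarrow> fps_nth (fps_nth g 0) 0 = 0"
  by (simp add: vanishing_ideal_def)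

lemma vanishing_ideal_antimono: "M \<le> N \<Longrightarrow> g \<in> vanishing_ideal N \<Longrightarrow> g \<in> vanishing_ideal M"
  by (auto simp: vanishing_ideal_def)

lemma zero_vanishing: "0 \<in> vanishing_ideal N"
  by (simp add: vanishing_ideal_def)

lemma add_vanishing: "g \<in> vanishing_ideal N \<Longrightarrow> h \<in> vanishing_ideal N \<Longrightarrow> g + h \<in> vanishing_ideal N"
  by (simp add: vanishing_ideal_def)

lemma diff_vanishing: "g \<in> vanishing_ideal N \<Longrightarrow> h \<in> vanishing_ideal N \<Longrightarrow> g - h \<in> vanishing_ideal N"
  by (simp add: vanishing_ideal_def)

lemma mult_vanishing:
  assumes "g \<in> vanishing_ideal M" "h \<in> vanishing_ideal N"
  shows "g * h \<in> vanishing_ideal (M + N)"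
  unfolding vanishing_ideal_def
proof (intro CollectI allI impI)
  fix i j :: nat assume ij: "i + j < M + N"
  have "fps_nth (fps_nth (g * h) j) i
      = (\<Sum>l=0..j. \<Sum>k=0..i. fps_nth (fps_nth g l) k * fps_nth (fps_nth h (j - l)) (i - k))"
    by (simp add: fps_mult_nth fps_sum_nth)
  also have "\<dots> = 0"
  proof (intro sum.neutral ballI)
    fix l k assume "l \<in> {0..j}" "k \<in> {0..i}"
    then have "k + l < M \<or> (i - k) + (j - l) < N" using ij by auto
    then show "fps_nth (fps_nth g l) k * fps_nth (fps_nth h (j - l)) (i - k) = 0"
      using assms vanishing_idealD by (metis mult_eq_0_iff)
  qed
  finally show "fps_nth (fps_nth (g * h) j) i = 0" .
qed

lemma mult_vanishing_left: "h \<in> vanishing_ideal N \<Longrightarrow> g * h \<in> vanishing_ideal N"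
  using mult_vanishing[of g 0 h N] by (simp add: vanishing_ideal_0)

lemma power_vanishing: "g \<in> vanishing_ideal 1 \<Longrightarrow> g ^ N \<in> vanishing_ideal N"
proof (induction N)
  case (Suc N)
  then show ?case using mult_vanishing[of g 1 "g ^ N" N] by simp
qed (simp add: vanishing_ideal_0)

lemma var_vanishing: "varX \<in> vanishing_ideal 1" "varY \<in> vanishing_ideal 1"
  by (simp_all add: vanishing_ideal_1 varX_def varY_def)

text \<open>
  Split off the part of \<open>g\<close> without \<open>Y\<close>; it is divisible by \<open>X\<close>.
\<close>

lemma vanishing_ideal_Suc:
  assumes "g \<in> vanishing_ideal (Suc N)"
  obtains g1 g2 where "g1 \<in> vanishing_ideal N" "g2 \<in> vanishing_ideal N" "g = varX * g1 + varY * g2"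
proof -
  define g1 where "g1 = fps_const (fps_shift 1 (fps_nth g 0))"
  define g2 where "g2 = fps_shift 1 g"
  have g00: "fps_nth (fps_nth g 0) 0 = 0" using vanishing_idealD[OF assms, of 0 0] by simp
  have "fps_nth g 0 = fps_X * fps_shift 1 (fps_nth g 0)"
    by (rule fps_ext) (use g00 in \<open>simp add: fps_X_mult_nth\<close>)
  then have "fps_nth g j = fps_nth (varX * g1 + varY * g2) j" for j
    by (cases j) (simp_all add: varX_def varY_def g1_def g2_def)
  then have "g = varX * g1 + varY * g2" by (rule fps_ext)
  moreover have "g1 \<in> vanishing_ideal N"
    using assms unfolding vanishing_ideal_def g1_def by simp
  moreover have "g2 \<in> vanishing_ideal N"
    using assms unfolding vanishing_ideal_def g2_def by simp
  ultimately show ?thesis using that by blast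
qed

lemma local_decomposition:
  obtains g1 g2 where "g = const2 (fps_nth (fps_nth g 0) 0) + varX * g1 + varY * g2"
proof -
  have "g - const2 (fps_nth (fps_nth g 0) 0) \<in> vanishing_ideal (Suc 0)"
    using vanishing_ideal_1[of "g - const2 (fps_nth (fps_nth g 0) 0)"] by (simp add: const2_def)
  then show ?thesis
    by (rule vanishing_ideal_Suc) (use that in \<open>metis add.assoc add_diff_cancel_left' diff_add_cancel add.commute\<close>)
qed

lemma unit_if_constant_term:
  fixes g :: "'a::field fps fps"
  assumes "fps_nth (fps_nth g 0) 0 \<noteq> 0"
  obtains h where "g * h = 1"
proof -
  have "1 = fps_nth (fps_nth g 0) 0 * inverse (fps_nth (fps_nth g 0) 0)" using assms by simp
  then have "\<exists>h. 1 = g * h"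
    unfolding fps_is_left_unit_iff_zeroth_is_left_unit by blast
  then show ?thesis using that by metis
qed

text \<open>
  The order of a power series with nonzero linear part is additive under powers: restrict to a
  coordinate line on which the linear part survives.
\<close>

lemma power_not_vanishing:
  assumes V: "V \<in> vanishing_ideal 1"
    and lin: "fps_nth (fps_nth V 0) 1 \<noteq> 0 \<or> fps_nth (fps_nth V 1) 0 \<noteq> 0"
  shows "V ^ k \<notin> vanishing_ideal (Suc k)"
proof
  assume Vk: "V ^ k \<in> vanishing_ideal (Suc k)"
  have simple_zero: "fps_nth (v ^ k) k \<noteq> 0" if "fps_nth v 0 = 0" "fps_nth v 1 \<noteq> 0" for v :: "'a fps"
  proof -
    have "v \<noteq> 0" using that by auto
    moreover have "subdegree v = 1" using that by (intro subdegreeI) auto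
    ultimately show ?thesis
      using nth_subdegree_nonzero[of "v ^ k"] by simp
  qed
  have V0: "fps_nth (fps_nth V 0) 0 = 0" using V by (simp add: vanishing_ideal_1)
  from lin show False
  proof
    assume "fps_nth (fps_nth V 0) 1 \<noteq> 0"
    then have "fps_nth (fps_nth V 0 ^ k) k \<noteq> 0" using simple_zero V0 by blast
    moreover have "fps_nth (V ^ k) 0 = fps_nth V 0 ^ k" by (simp add: fps_power_zeroth)
    ultimately show False using vanishing_idealD[OF Vk, of k 0] by simp
  next
    assume V1: "fps_nth (fps_nth V 1) 0 \<noteq> 0"
    \<comment> \<open>restriction to the line \<open>X = 0\<close>\<close>
    define \<psi> where "\<psi> g = Abs_fps (\<lambda>j. fps_nth (fps_nth g j) 0)" for g :: "'a fps fps"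
    have "\<psi> (g * h) = \<psi> g * \<psi> h" for g h
      by (rule fps_ext) (simp add: \<psi>_def fps_mult_nth fps_sum_nth)
    moreover have "\<psi> 1 = 1" by (rule fps_ext) (simp add: \<psi>_def)
    ultimately have "\<psi> (V ^ k) = \<psi> V ^ k" by (induction k) simp_all
    moreover have "fps_nth (\<psi> V ^ k) k \<noteq> 0" using simple_zero[of "\<psi> V"] V0 V1 by (simp add: \<psi>_def)
    ultimately have "fps_nth (fps_nth (V ^ k) k) 0 \<noteq> 0" by (metis \<psi>_def fps_nth_Abs_fps)
    then show False using vanishing_idealD[OF Vk, of 0 k] by simp
  qed
qed

section \<open>Regular systems of parameters\<close>

definition regular_parameters :: "'a::field fps fps \<Rightarrow> 'a fps fps \<Rightarrow> bool" where
  "regular_parameters U V \<longleftrightarrow> U \<in> vanishing_ideal 1 \<and> V \<in> vanishing_ideal 1 \<and>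
     (\<exists>a b. varX = a * U + b * V) \<and> (\<exists>a b. varY = a * U + b * V)"

text \<open>
  Writing \<open>U\<close>, \<open>V\<close> in terms of \<open>X\<close>, \<open>Y\<close> gives a matrix over \<open>k[[X,Y]]\<close> whose determinant is a unit;
  Cramer's rule solves for \<open>X\<close> and \<open>Y\<close>.
\<close>

lemma regular_parameters_if_independent:
  assumes "U \<in> vanishing_ideal 1" "V \<in> vanishing_ideal 1"
    and det: "fps_nth (fps_nth U 0) 1 * fps_nth (fps_nth V 1) 0
      \<noteq> fps_nth (fps_nth U 1) 0 * fps_nth (fps_nth V 0) 1"
  shows "regular_parameters U V"
proof -
  obtain A B where U: "U = varX * A + varY * B"
    using vanishing_ideal_Suc[of U 0] assms(1) unfolding One_nat_def by blast
  obtain C D where V: "V = varX * C + varY * D"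
    using vanishing_ideal_Suc[of V 0] assms(2) unfolding One_nat_def by blast
  have lin: "fps_nth (fps_nth (varX * g + varY * h) 0) 1 = fps_nth (fps_nth g 0) 0"
      "fps_nth (fps_nth (varX * g + varY * h) 1) 0 = fps_nth (fps_nth h 0) 0" for g h :: "'a fps fps"
    by (simp_all add: varX_def varY_def)
  have "fps_nth (fps_nth (A * D - B * C) 0) 0 \<noteq> 0"
    using det unfolding U V lin by simp
  then obtain W where W: "(A * D - B * C) * W = 1" by (rule unit_if_constant_term)
  have "varX = (A * D - B * C) * W * varX" using W by simp
  also have "\<dots> = (D * W) * U + (- B * W) * V" by (simp add: U V algebra_simps)
  finally have X: "varX = (D * W) * U + (- B * W) * V" .
  have "varY = (A * D - B * C) * W * varY" using W by simp
  also have "\<dots> = (- C * W) * U + (A * W) * V" by (simp add: U V algebra_simps)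
  finally have "varY = (- C * W) * U + (A * W) * V" .
  with X show ?thesis using assms unfolding regular_parameters_def by blast
qed

lemma homogeneous_approximation:
  assumes UV: "regular_parameters U V" and "g \<in> vanishing_ideal N"
  shows "\<exists>d. g - (\<Sum>i\<le>N. const2 (d i) * U ^ i * V ^ (N - i)) \<in> vanishing_ideal (Suc N)"
  using assms(2)
proof (induction N arbitrary: g)
  case 0
  have "g - const2 (fps_nth (fps_nth g 0) 0) \<in> vanishing_ideal (Suc 0)"
    using vanishing_ideal_1[of "g - const2 (fps_nth (fps_nth g 0) 0)"] by (simp add: const2_def)
  then show ?case by (intro exI[of _ "\<lambda>_. fps_nth (fps_nth g 0) 0"]) simp
next
  case (Suc N)
  obtain a b c d where X: "varX = a * U + b * V" and Y: "varY = c * U + d * V"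
    and U1: "U \<in> vanishing_ideal 1" and V1: "V \<in> vanishing_ideal 1"
    using UV unfolding regular_parameters_def by blast
  obtain g1 g2 where g: "g1 \<in> vanishing_ideal N" "g2 \<in> vanishing_ideal N" "g = varX * g1 + varY * g2"
    using vanishing_ideal_Suc[OF Suc.prems] .
  define h1 where "h1 = a * g1 + c * g2"
  define h2 where "h2 = b * g1 + d * g2"
  have gh: "g = U * h1 + V * h2" by (simp add: g(3) X Y h1_def h2_def algebra_simps)
  have "h1 \<in> vanishing_ideal N" "h2 \<in> vanishing_ideal N"
    unfolding h1_def h2_def by (intro add_vanishing mult_vanishing_left g)+
  then obtain d1 d2 where
    d1: "h1 - (\<Sum>i\<le>N. const2 (d1 i) * U ^ i * V ^ (N - i)) \<in> vanishing_ideal (Suc N)" and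
    d2: "h2 - (\<Sum>i\<le>N. const2 (d2 i) * U ^ i * V ^ (N - i)) \<in> vanishing_ideal (Suc N)"
    using Suc.IH by meson
  define s1 where "s1 = (\<Sum>i\<le>N. const2 (d1 i) * U ^ i * V ^ (N - i))"
  define s2 where "s2 = (\<Sum>i\<le>N. const2 (d2 i) * U ^ i * V ^ (N - i))"
  define d where "d i = (if i = 0 then 0 else d1 (i - 1)) + (if i \<le> N then d2 i else 0)" for i
  have const2_add: "const2 (\<alpha> + \<beta>) = const2 \<alpha> + const2 \<beta>" for \<alpha> \<beta> :: 'a
    by (simp add: const2_def)
  have const2_0: "const2 (0::'a) = 0" by (simp add: const2_def)
  have "(\<Sum>i\<le>Suc N. const2 (d i) * U ^ i * V ^ (Suc N - i))
      = (\<Sum>i\<le>Suc N. const2 (if i = 0 then 0 else d1 (i - 1)) * U ^ i * V ^ (Suc N - i))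
      + (\<Sum>i\<le>Suc N. const2 (if i \<le> N then d2 i else 0) * U ^ i * V ^ (Suc N - i))"
    by (simp only: d_def const2_add sum.distrib[symmetric] distrib_right)
  also have "(\<Sum>i\<le>Suc N. const2 (if i = 0 then 0 else d1 (i - 1)) * U ^ i * V ^ (Suc N - i)) = U * s1"
    unfolding s1_def sum.atMost_Suc_shift sum_distrib_left
    by (simp add: const2_0 algebra_simps)
  also have "(\<Sum>i\<le>Suc N. const2 (if i \<le> N then d2 i else 0) * U ^ i * V ^ (Suc N - i)) = V * s2"
    unfolding s2_def sum_distrib_left by (simp add: const2_0 Suc_diff_le algebra_simps)
  finally have "g - (\<Sum>i\<le>Suc N. const2 (d i) * U ^ i * V ^ (Suc N - i)) = U * (h1 - s1) + V * (h2 - s2)"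
    by (simp add: gh algebra_simps)
  moreover have "U * (h1 - s1) + V * (h2 - s2) \<in> vanishing_ideal (1 + Suc N)"
    using d1 d2 U1 V1 unfolding s1_def[symmetric] s2_def[symmetric]
    by (intro add_vanishing mult_vanishing)
  ultimately show ?case by (intro exI[of _ d]) simp
qed

text \<open>
  Successive approximation, removing in step \<open>N\<close> the form of degree \<open>N\<close> of the remainder.
\<close>

lemma expansion_in_regular_parameters:
  fixes h :: "'a::field fps fps"
  assumes "regular_parameters U V"
  obtains c :: "nat \<Rightarrow> nat \<Rightarrow> 'a" where
    "\<And>N. h - (\<Sum>(i, j) \<in> {(i, j). i + j < N}. const2 (c i j) * U ^ i * V ^ j) \<in> vanishing_ideal N"
proof -
  define D where "D g N = (SOME d. g - (\<Sum>i\<le>N. const2 (d i) * U ^ i * V ^ (N - i))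
      \<in> vanishing_ideal (Suc N))" for g :: "'a fps fps" and N
  have D: "g - (\<Sum>i\<le>N. const2 (D g N i) * U ^ i * V ^ (N - i)) \<in> vanishing_ideal (Suc N)"
    if "g \<in> vanishing_ideal N" for g N
    using someI_ex[OF homogeneous_approximation[OF assms that]] unfolding D_def .
  define p where "p = rec_nat 0 (\<lambda>N q. q + (\<Sum>i\<le>N. const2 (D (h - q) N i) * U ^ i * V ^ (N - i)))"
  have p0: "p 0 = 0"
    and pS: "p (Suc N) = p N + (\<Sum>i\<le>N. const2 (D (h - p N) N i) * U ^ i * V ^ (N - i))" for N
    by (simp_all add: p_def)
  have in_ideal: "h - p N \<in> vanishing_ideal N" for N
  proof (induction N)
    case (Suc N)
    then show ?case using D[OF Suc] by (simp add: pS algebra_simps)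
  qed (simp add: vanishing_ideal_0)
  define c where "c i j = D (h - p (i + j)) (i + j) i" for i j
  have "p N = (\<Sum>(i, j) \<in> {(i, j). i + j < N}. const2 (c i j) * U ^ i * V ^ j)" for N
  proof (induction N)
    case (Suc N)
    have fin: "finite {(i, j). i + j < (k::nat)}" for k
      by (rule finite_subset[of _ "{..<k} \<times> {..<k}"]) auto
    have "{(i, j). i + j < Suc N} = {(i, j). i + j < N} \<union> (\<lambda>i. (i, N - i)) ` {..N}" by force
    moreover have "{(i, j). i + j < N} \<inter> (\<lambda>i. (i, N - i)) ` {..N} = {}" by auto
    moreover have "inj_on (\<lambda>i. (i, N - i)) {..N}" by (auto simp: inj_on_def)
    ultimately show ?case
      using fin[of N] by (simp add: sum.union_disjoint sum.reindex pS Suc c_def)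
  qed (simp add: p0)
  then show ?thesis using that[of c] in_ideal by simp
qed

section \<open>Parametrizations of plane branches\<close>

lemma const2_simps:
  "const2 0 = 0" "const2 1 = 1"
  by (simp_all add: const2_def)

text \<open>
  Modulo \<open>e\<close> the exponent determines \<open>j'\<close> up to multiples of \<open>e\<close>, and exchanging \<open>e\<close> copies of \<open>m\<close>
  for \<open>m\<close> copies of \<open>e\<close> requires \<open>i \<ge> m\<close>, which is excluded.
\<close>

lemma monomial_exponents_unique:
  fixes e m i j i' j' :: nat
  assumes "coprime e m" "e < m" "i + j < e" and eq: "e * i' + m * j' = e * i + m * j"
  shows "i' = i \<and> j' = j"
proof -
  have "e dvd m * (int j' - int j)"
  proof -
    have "int e * int i' + int m * int j' = int e * int i + int m * int j"
      using eq by (metis of_nat_add of_nat_mult)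
    then have "int m * (int j' - int j) = int e * (int i - int i')" by (simp add: algebra_simps)
    then show ?thesis by (metis dvd_triv_left)
  qed
  then have dvd: "int e dvd int j' - int j"
    using assms(1) by (metis coprime_dvd_mult_right_iff coprime_int_iff)
  have "j' = j"
  proof (rule ccontr)
    assume "j' \<noteq> j"
    then consider "j' < j" | "j < j'" by linarith
    then show False
    proof cases
      case 1
      then have "int (j - j') = - (int j' - int j)" by simp
      then have "e dvd j - j'" using dvd by (metis dvd_minus_iff of_nat_dvd_iff)
      then have "e \<le> j - j'" using 1 by (simp add: dvd_imp_le)
      then show False using assms(3) by simp
    next
      case 2
      then have "int (j' - j) = int j' - int j" by simp
      then have "e dvd j' - j" using dvd by (metis of_nat_dvd_iff)
      then have "e \<le> j' - j" using 2 by (simp add: dvd_imp_le)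
      then have "m * (j + e) \<le> m * j'" using 2 by (intro mult_le_mono) auto
      then have "m * j + m * e \<le> m * j'" by (simp only: distrib_left)
      then have "m * e \<le> e * i" using eq by linarith
      then have "e * m \<le> e * i" by (simp only: mult.commute)
      then show False using assms(2,3) by simp
    qed
  qed
  then show ?thesis using eq assms(3) by auto
qed

text \<open>
  A parametrization \<open>k[[X,Y]] \<rightarrow> k[[t]]\<close> of the curve \<open>f = 0\<close>, where \<open>t\<close> is a quotient of two elements
  of the image. The last condition says that the curve is singular at the origin.
\<close>

locale parametrization =
  fixes \<phi> :: "'a::field_char_0 fps fps \<Rightarrow> 'a fps" and f :: "'a fps fps"
  assumes add: "\<phi> (g + h) = \<phi> g + \<phi> h"
    and mult: "\<phi> (g * h) = \<phi> g * \<phi> h"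
    and const: "\<phi> (const2 c) = fps_const c"
    and kernel: "\<phi> g = 0 \<longleftrightarrow> f dvd g"
    and birational: "\<exists>u v. \<phi> v \<noteq> 0 \<and> \<phi> v * fps_X = \<phi> u"
    and singular: "f \<in> vanishing_ideal 2"
begin

lemma zero: "\<phi> 0 = 0"
  using const[of 0] by (simp add: const2_simps)

lemma one: "\<phi> 1 = 1"
  using const[of 1] by (simp add: const2_simps)

lemma diff: "\<phi> (g - h) = \<phi> g - \<phi> h"
  using add[of "g - h" h] by simp

lemma power: "\<phi> (g ^ n) = \<phi> g ^ n"
  by (induction n) (simp_all add: one mult)

lemma sum: "\<phi> (sum F I) = (\<Sum>i\<in>I. \<phi> (F i))"
  by (induction I rule: infinite_finite_induct) (simp_all add: zero add)

text \<open>
  \<open>\<phi>\<close> is automatically local: if \<open>\<phi> g\<close> had a constant term \<open>c \<noteq> 0\<close>, the image of the unit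
  \<open>c - g\<close> would not be a unit.
\<close>

lemma nonunit:
  assumes "g \<in> vanishing_ideal 1"
  shows "fps_nth (\<phi> g) 0 = 0"
proof (rule ccontr)
  define c where "c = fps_nth (\<phi> g) 0"
  assume "fps_nth (\<phi> g) 0 \<noteq> 0"
  then have "fps_nth (fps_nth (const2 c - g) 0) 0 \<noteq> 0"
    using assms by (simp add: const2_def c_def)
  then obtain h where "(const2 c - g) * h = 1" by (rule unit_if_constant_term)
  then have "\<phi> (const2 c - g) * \<phi> h = 1" using mult one by metis
  then have "(fps_const c - \<phi> g) * \<phi> h = 1" by (simp add: diff const)
  then have "fps_nth ((fps_const c - \<phi> g) * \<phi> h) 0 = 1" by simp
  then show False by (simp add: c_def)
qed

lemma continuous: "g \<in> vanishing_ideal N \<Longrightarrow> fps_X ^ N dvd \<phi> g"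
proof (induction N arbitrary: g)
  case (Suc N)
  obtain g1 g2 where g: "g1 \<in> vanishing_ideal N" "g2 \<in> vanishing_ideal N" "g = varX * g1 + varY * g2"
    using vanishing_ideal_Suc[OF Suc.prems] .
  have "fps_X dvd \<phi> varX" "fps_X dvd \<phi> varY"
    using nonunit[OF var_vanishing(1)] nonunit[OF var_vanishing(2)]
      X_power_dvd_iff_nth[of 1 "\<phi> varX"] X_power_dvd_iff_nth[of 1 "\<phi> varY"] by auto
  then show ?case using Suc.IH[OF g(1)] Suc.IH[OF g(2)]
    unfolding g(3) add mult power_Suc by (intro dvd_add mult_dvd_mono)
qed simp

lemma image_of_series:
  assumes Z: "Z \<in> vanishing_ideal 1"
    and approx: "\<And>K. g - (\<Sum>i<K. const2 (fps_nth p i) * Z ^ i) \<in> vanishing_ideal K"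
  shows "\<phi> g = p oo \<phi> Z"
proof -
  have "fps_X ^ K dvd \<phi> g - (p oo \<phi> Z)" for K
  proof -
    define q where "q = (\<Sum>i<K. fps_const (fps_nth p i) * \<phi> Z ^ i)"
    have "fps_X ^ K dvd \<phi> g - q"
      using continuous[OF approx[of K]] by (simp add: q_def diff sum mult const power)
    moreover have "fps_X ^ K dvd (p oo \<phi> Z) - q"
      unfolding q_def by (rule dvd_compose_minus_truncation[OF nonunit[OF Z]])
    ultimately have "fps_X ^ K dvd (\<phi> g - q) - ((p oo \<phi> Z) - q)" by (rule dvd_diff)
    then show ?thesis by simp
  qed
  then show ?thesis using eq_0_if_X_powers_dvd[of "\<phi> g - (p oo \<phi> Z)"] by simp
qed

definition series_in_X :: "'a fps \<Rightarrow> 'a fps fps" where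
  "series_in_X p = fps_const p"

definition series_in_Y :: "'a fps \<Rightarrow> 'a fps fps" where
  "series_in_Y p = Abs_fps (\<lambda>j. fps_const (fps_nth p j))"

lemma image_series_in_X: "\<phi> (series_in_X p) = p oo \<phi> varX"
proof (rule image_of_series[OF var_vanishing(1)])
  fix K
  have "(\<Sum>i<K. const2 (fps_nth p i) * varX ^ i) = fps_const (\<Sum>i<K. fps_const (fps_nth p i) * fps_X ^ i)"
    by (induction K) (simp_all add: const2_def varX_def)
  moreover have "fps_nth (\<Sum>i<K. fps_const (fps_nth p i) * fps_X ^ i) j = fps_nth p j" if "j < K" for j
    using that by (simp add: fps_sum_nth fps_X_power_nth if_distrib sum.delta cong: if_cong)
  ultimately show "series_in_X p - (\<Sum>i<K. const2 (fps_nth p i) * varX ^ i) \<in> vanishing_ideal K"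
    by (auto simp: vanishing_ideal_def series_in_X_def)
qed

lemma image_series_in_Y: "\<phi> (series_in_Y p) = p oo \<phi> varY"
proof (rule image_of_series[OF var_vanishing(2)])
  fix K
  have "fps_nth (\<Sum>i<K. const2 (fps_nth p i) * varY ^ i) j = fps_const (fps_nth p j)" if "j < K" for j
    using that by (simp add: fps_sum_nth fps_X_power_nth const2_def varY_def if_distrib sum.delta cong: if_cong)
  then show "series_in_Y p - (\<Sum>i<K. const2 (fps_nth p i) * varY ^ i) \<in> vanishing_ideal K"
    by (auto simp: vanishing_ideal_def series_in_Y_def)
qed

text \<open>
  A coordinate in the kernel would be a multiple of \<open>f\<close>, which has no linear term.
\<close>

lemma coordinate_nonzero: "\<phi> varX \<noteq> 0" "\<phi> varY \<noteq> 0"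
proof -
  have "(varX :: 'a fps fps) \<notin> vanishing_ideal 2" "(varY :: 'a fps fps) \<notin> vanishing_ideal 2"
    using vanishing_idealD[of "varX :: 'a fps fps" 2 1 0] vanishing_idealD[of "varY :: 'a fps fps" 2 0 1]
    by (auto simp: varX_def varY_def)
  then show "\<phi> varX \<noteq> 0" "\<phi> varY \<noteq> 0"
    using kernel mult_vanishing_left[OF singular] by (metis dvd_def mult.commute)+
qed

text \<open>
  \<open>k[[t]]\<close> is free over \<open>k[[x]]\<close> with basis \<open>1, t, ..., t^(e-1)\<close>; multiplying by a power of a
  denominator of \<open>t\<close> therefore moves all of \<open>k[[t]]\<close> into the branch.
\<close>

lemma conductor_exists:
  assumes x: "fps_nth x 0 = 0" "x \<noteq> 0" and lift: "\<And>p. p oo x \<in> range \<phi>"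
  shows "\<exists>C. \<forall>g. fps_X ^ C dvd g \<longrightarrow> g \<in> range \<phi>"
proof -
  obtain u v where uv: "\<phi> v \<noteq> 0" "\<phi> v * fps_X = \<phi> u" using birational by blast
  define e where "e = subdegree x"
  define C where "C = subdegree (\<phi> v ^ e)"
  have "g \<in> range \<phi>" if g: "fps_X ^ C dvd g" for g
  proof -
    have "\<phi> v ^ e dvd fps_X ^ C" using uv(1) by (simp add: fps_dvd_iff fps_X_power_subdegree C_def)
    then obtain k where k: "g = \<phi> v ^ e * k" using g by (meson dvd_def dvd_trans)
    obtain c where c: "k = (\<Sum>j<e. (c j oo x) * fps_X ^ j)"
      using generated_over_subseries[OF x] unfolding e_def by blast
    have "\<forall>j. \<exists>h. c j oo x = \<phi> h" using lift by blast
    from choice[OF this] obtain G where "\<forall>j. c j oo x = \<phi> (G j)" ..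
    then have G: "c j oo x = \<phi> (G j)" for j ..
    have vX: "\<phi> v ^ e * fps_X ^ j = \<phi> (v ^ (e - j) * u ^ j)" if "j < e" for j
    proof -
      have "\<phi> v ^ e = \<phi> v ^ (e - j) * \<phi> v ^ j" using that by (simp flip: power_add)
      then show ?thesis by (simp add: mult power uv(2)[symmetric] power_mult_distrib)
    qed
    have "g = (\<Sum>j<e. \<phi> v ^ e * (\<phi> (G j) * fps_X ^ j))"
      by (simp only: k c sum_distrib_left G)
    also have "\<dots> = (\<Sum>j<e. \<phi> (G j * (v ^ (e - j) * u ^ j)))"
    proof (rule sum.cong[OF refl])
      fix j assume "j \<in> {..<e}"
      then have "\<phi> (G j * (v ^ (e - j) * u ^ j)) = \<phi> (G j) * (\<phi> v ^ e * fps_X ^ j)"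
        by (simp only: mult[of "G j"] vX lessThan_iff)
      then show "\<phi> v ^ e * (\<phi> (G j) * fps_X ^ j) = \<phi> (G j * (v ^ (e - j) * u ^ j))"
        by (simp only: mult_ac)
    qed
    finally have "g = \<phi> (\<Sum>j<e. G j * (v ^ (e - j) * u ^ j))" by (simp only: sum)
    then show ?thesis by blast
  qed
  then show ?thesis by blast
qed

text \<open>
  The \<open>e + 1\<close> elements \<open>1, y, ..., y^e\<close> of a \<open>k[[x]]\<close>-module with \<open>e\<close> generators are linearly
  dependent. Dividing the relation by the largest possible power of \<open>x\<close> makes one coefficient a
  unit.
\<close>

lemma algebraic_relation:
  fixes x y :: "'a fps"
  assumes x: "fps_nth x 0 = 0" "x \<noteq> 0"
  obtains c k where "(\<Sum>i\<le>subdegree x. (c i oo x) * y ^ i) = 0" "k \<le> subdegree x" "fps_nth (c k) 0 \<noteq> 0"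
proof -
  define e where "e = subdegree x"
  have "\<forall>i. \<exists>v. y ^ i = (\<Sum>j<e. (v j oo x) * fps_X ^ j)"
    using generated_over_subseries[OF x] unfolding e_def by blast
  from choice[OF this] obtain v where "\<forall>i. y ^ i = (\<Sum>j<e. (v i j oo x) * fps_X ^ j)" ..
  then have v: "y ^ i = (\<Sum>j<e. (v i j oo x) * fps_X ^ j)" for i ..
  obtain c where c: "\<exists>i\<in>{..e}. c i \<noteq> 0" "\<forall>j\<in>{..<e}. (\<Sum>i\<in>{..e}. c i * v i j) = 0"
    using linear_relation_over_domain[of "{..<e}" "{..e}" v] by auto
  have rel: "(\<Sum>i\<le>e. (c i oo x) * y ^ i) = 0"
  proof -
    have "(\<Sum>i\<le>e. (c i oo x) * y ^ i) = (\<Sum>i\<le>e. \<Sum>j<e. ((c i * v i j) oo x) * fps_X ^ j)"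
      by (subst v) (simp add: sum_distrib_left fps_compose_mult_distrib[OF x(1)] mult.assoc)
    also have "\<dots> = (\<Sum>j<e. ((\<Sum>i\<le>e. c i * v i j) oo x) * fps_X ^ j)"
      by (subst sum.swap) (simp add: fps_compose_sum_distrib sum_distrib_right)
    finally show ?thesis using c(2) by simp
  qed
  obtain k where k: "k \<le> e" "c k \<noteq> 0" "\<And>i. i \<le> e \<Longrightarrow> c i \<noteq> 0 \<Longrightarrow> subdegree (c k) \<le> subdegree (c i)"
  proof -
    obtain i where "i \<le> e \<and> c i \<noteq> 0" using c(1) by auto
    from ex_has_least_nat[of "\<lambda>i. i \<le> e \<and> c i \<noteq> 0", OF this, of "\<lambda>i. subdegree (c i)"]
    show ?thesis using that by blast
  qed
  define d where "d = subdegree (c k)"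
  define c' where "c' i = fps_shift d (c i)" for i
  have c': "c i = fps_X ^ d * c' i" if "i \<le> e" for i
  proof -
    have "fps_X ^ d dvd c i"
      using k(3)[OF that] unfolding X_power_dvd_iff_subdegree d_def by blast
    then obtain r where "c i = fps_X ^ d * r" ..
    then have "c' i = r" unfolding c'_def by (intro fps_ext) (simp add: fps_X_power_mult_nth)
    then show ?thesis using \<open>c i = fps_X ^ d * r\<close> by simp
  qed
  have "x ^ d * (\<Sum>i\<le>e. (c' i oo x) * y ^ i) = (\<Sum>i\<le>e. (c i oo x) * y ^ i)"
    unfolding sum_distrib_left
    by (intro sum.cong refl)
      (simp add: c' fps_compose_mult_distrib[OF x(1)] fps_X_power_compose[OF x(1)] mult.assoc)
  then have "(\<Sum>i\<le>e. (c' i oo x) * y ^ i) = 0" using rel x(2) by simp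
  moreover have "fps_nth (c' k) 0 \<noteq> 0" using k(2) by (simp add: c'_def d_def)
  ultimately show ?thesis using that k(1) unfolding e_def by blast
qed

text \<open>
  The relation of degree \<open>e\<close> between the coordinates is a multiple of \<open>f\<close>, and it contains a pure
  power, of exponent at most \<open>e\<close>, of one of the variables with nonzero coefficient. So its order,
  and all the more that of \<open>f\<close>, is at most \<open>e\<close>.
\<close>

lemma order_le_branch_order:
  assumes "f \<in> vanishing_ideal n"
  shows "n \<le> subdegree (\<phi> varX)" "n \<le> subdegree (\<phi> varY)"
proof -
  show "n \<le> subdegree (\<phi> varX)"
  proof (rule ccontr)
    assume less: "\<not> ?thesis"
    obtain c k where c: "(\<Sum>i\<le>subdegree (\<phi> varX). (c i oo \<phi> varX) * \<phi> varY ^ i) = 0"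
      "k \<le> subdegree (\<phi> varX)" "fps_nth (c k) 0 \<noteq> 0"
      using algebraic_relation[OF nonunit[OF var_vanishing(1)] coordinate_nonzero(1)] .
    define G where "G = (\<Sum>i\<le>subdegree (\<phi> varX). series_in_X (c i) * varY ^ i)"
    have "\<phi> G = 0" using c(1) by (simp add: G_def sum mult power image_series_in_X)
    then have "G \<in> vanishing_ideal n" using kernel mult_vanishing_left[OF assms] by (metis dvd_def mult.commute)
    then have "fps_nth (fps_nth G k) 0 = 0" using less c(2) by (intro vanishing_idealD) auto
    moreover have "fps_nth G k = c k"
      using c(2) by (simp add: G_def series_in_X_def varY_def fps_sum_nth fps_X_power_nth
          if_distrib sum.delta cong: if_cong)
    ultimately show False using c(3) by simp
  qed
  show "n \<le> subdegree (\<phi> varY)"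
  proof (rule ccontr)
    assume less: "\<not> ?thesis"
    obtain c k where c: "(\<Sum>i\<le>subdegree (\<phi> varY). (c i oo \<phi> varY) * \<phi> varX ^ i) = 0"
      "k \<le> subdegree (\<phi> varY)" "fps_nth (c k) 0 \<noteq> 0"
      using algebraic_relation[OF nonunit[OF var_vanishing(2)] coordinate_nonzero(2)] .
    define G where "G = (\<Sum>i\<le>subdegree (\<phi> varY). series_in_Y (c i) * varX ^ i)"
    have "\<phi> G = 0" using c(1) by (simp add: G_def sum mult power image_series_in_Y)
    then have "G \<in> vanishing_ideal n" using kernel mult_vanishing_left[OF assms] by (metis dvd_def mult.commute)
    then have "fps_nth (fps_nth G 0) k = 0" using less c(2) by (intro vanishing_idealD) auto
    moreover have "fps_nth (fps_nth G 0) k = fps_nth (c k) 0"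
      using c(2) by (simp add: G_def series_in_Y_def varX_def fps_sum_nth fps_X_power_nth
          if_distrib sum.delta cong: if_cong)
    ultimately show False using c(3) by simp
  qed
qed

lemma plane_branch_of_coordinates:
  assumes PQ: "(P = varX \<and> Q = varY) \<or> (P = varY \<and> Q = varX)"
    and le: "subdegree (\<phi> P) \<le> subdegree (\<phi> Q)"
  shows "plane_branch (range \<phi>) (\<phi> P) (\<phi> Q)"
proof
  have lift: "p oo \<phi> P \<in> range \<phi>" for p
    using PQ image_series_in_X[of p] image_series_in_Y[of p] by (metis rangeI)
  have P: "fps_nth (\<phi> P) 0 = 0" "\<phi> P \<noteq> 0"
    using PQ nonunit var_vanishing coordinate_nonzero by blast+
  show "fps_const c \<in> range \<phi>" for c using const by (metis rangeI)
  show "s + s' \<in> range \<phi>" if "s \<in> range \<phi>" "s' \<in> range \<phi>" for s s'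
    using that by (auto simp flip: add)
  show "s * s' \<in> range \<phi>" if "s \<in> range \<phi>" "s' \<in> range \<phi>" for s s'
    using that by (auto simp flip: mult)
  show "\<exists>c s1 s2. s1 \<in> range \<phi> \<and> s2 \<in> range \<phi> \<and> s = fps_const c + \<phi> P * s1 + \<phi> Q * s2"
    if s: "s \<in> range \<phi>" for s
  proof -
    obtain g where g: "s = \<phi> g" using s by blast
    obtain g1 g2 where "g = const2 (fps_nth (fps_nth g 0) 0) + varX * g1 + varY * g2"
      by (rule local_decomposition)
    then have XY: "s = fps_const (fps_nth (fps_nth g 0) 0) + \<phi> varX * \<phi> g1 + \<phi> varY * \<phi> g2"
      unfolding g by (metis add mult const)
    then have YX: "s = fps_const (fps_nth (fps_nth g 0) 0) + \<phi> varY * \<phi> g2 + \<phi> varX * \<phi> g1"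
      by (simp add: ac_simps)
    from PQ show ?thesis
    proof (elim disjE conjE)
      assume "P = varX" "Q = varY"
      then show ?thesis using XY by blast
    next
      assume "P = varY" "Q = varX"
      then show ?thesis using YX by blast
    qed
  qed
  show "\<exists>C. \<forall>g. fps_X ^ C dvd g \<longrightarrow> g \<in> range \<phi>"
    by (rule conductor_exists[OF P lift])
  show "2 \<le> subdegree (\<phi> P)" using order_le_branch_order[OF singular] PQ by blast
  show "fps_X ^ subdegree (\<phi> P) dvd \<phi> Q" using le unfolding X_power_dvd_iff_subdegree by blast
  show "\<phi> P \<in> range \<phi>" "\<phi> Q \<in> range \<phi>" by (rule rangeI)+
qed

lemma branch_coordinates:
  obtains x y where "reduced_branch (range \<phi>) x y" "\<And>n. f \<in> vanishing_ideal n \<Longrightarrow> n \<le> subdegree x"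
proof -
  have "\<exists>P Q. plane_branch (range \<phi>) (\<phi> P) (\<phi> Q) \<and> (P = varX \<or> P = varY)"
    using plane_branch_of_coordinates[of varX varY] plane_branch_of_coordinates[of varY varX]
    by (metis nle_le)
  then obtain P Q where PQ: "plane_branch (range \<phi>) (\<phi> P) (\<phi> Q)" "P = varX \<or> P = varY" by blast
  obtain y where "plane_branch (range \<phi>) (\<phi> P) y" "\<not> subdegree (\<phi> P) dvd subdegree y"
    using plane_branch.reduced_generator[OF PQ(1)] .
  then have "reduced_branch (range \<phi>) (\<phi> P) y"
    by (simp add: reduced_branch_def reduced_branch_axioms_def)
  then show ?thesis using that PQ(2) order_le_branch_order by blast
qed

text \<open>
  If the linear parts of \<open>U\<close> and \<open>V\<close> were dependent, some nontrivial combination of \<open>\<tau>^e\<close> and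
  \<open>\<tau>^m\<close> would be in the square of the maximal ideal of the branch. But such a combination has order
  \<open>e\<close> or \<open>m\<close>, while elements of that square have order at least \<open>2 e\<close> and different from \<open>m\<close>.
\<close>

lemma monomial_regular_parameters:
  assumes "reduced_branch (range \<phi>) x y" and \<tau>: "subdegree \<tau> = 1"
    and U: "\<phi> U = \<tau> ^ subdegree x" and V: "\<phi> V = \<tau> ^ subdegree y"
  shows "regular_parameters U V"
proof -
  interpret reduced_branch "range \<phi>" x y by fact
  have \<tau>_nz: "\<tau> \<noteq> 0" using \<tau> by auto
  have \<tau>0: "fps_nth \<tau> 0 = 0" by (rule nth_less_subdegree_zero) (simp add: \<tau>)
  have local: "g \<in> vanishing_ideal 1" if "fps_nth (\<phi> g) 0 = 0" for g
  proof -
    define c where "c = fps_nth (fps_nth g 0) 0"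
    have "g - const2 c \<in> vanishing_ideal 1" by (simp add: c_def const2_def)
    then have "fps_nth (\<phi> (g - const2 c)) 0 = 0" by (rule nonunit)
    then have "c = 0" using that by (simp add: diff const)
    then show ?thesis by (simp add: c_def)
  qed
  have e0: "0 < e" "0 < m" using two_le_order e_less_m by linarith+
  have U1: "U \<in> vanishing_ideal 1" and V1: "V \<in> vanishing_ideal 1"
    using e0 by (intro local; simp add: U V fps_power_zeroth \<tau>0)+
  have square: "\<phi> g \<in> square_like \<and> fps_X ^ (2 * e) dvd \<phi> g" if g: "g \<in> vanishing_ideal 2" for g
  proof -
    obtain g1 g2 where g12: "g1 \<in> vanishing_ideal 1" "g2 \<in> vanishing_ideal 1"
        "g = varX * g1 + varY * g2"
      using vanishing_ideal_Suc[of g 1] g by (metis Suc_1)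
    have *: "\<phi> a * \<phi> b \<in> square_like \<and> fps_X ^ (2 * e) dvd \<phi> a * \<phi> b"
      if "a \<in> vanishing_ideal 1" "b \<in> vanishing_ideal 1" for a b
      using product_square_like[of "\<phi> a" "\<phi> b"] nonunit[OF that(1)] nonunit[OF that(2)]
        nonunit_order_ge[of "\<phi> a"] nonunit_order_ge[of "\<phi> b"]
      by (simp add: mult_2 power_add mult_dvd_mono)
    show ?thesis
      using *[OF var_vanishing(1) g12(1)] *[OF var_vanishing(2) g12(2)]
      by (simp add: g12(3) add mult square_like_add)
  qed
  have independent: "s = 0 \<and> t = 0" if st: "const2 s * U + const2 t * V \<in> vanishing_ideal 2" for s t
  proof -
    define z where "z = fps_const s * \<tau> ^ e + fps_const t * \<tau> ^ m"
    have z: "z \<in> square_like" "fps_X ^ (2 * e) dvd z"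
      using square[OF st] by (simp_all add: z_def add mult const U V)
    have s: "s = 0"
    proof (rule ccontr)
      assume "s \<noteq> 0"
      have se: "subdegree (\<tau> ^ e) = e" "subdegree (\<tau> ^ m) = m" using \<tau> by simp_all
      have "fps_nth (\<tau> ^ e) e \<noteq> 0" using \<tau>_nz se by (metis nth_subdegree_nonzero power_not_zero)
      moreover have "fps_nth (\<tau> ^ m) e = 0"
        by (rule nth_less_subdegree_zero) (simp only: se e_less_m)
      ultimately have "fps_nth z e \<noteq> 0" using \<open>s \<noteq> 0\<close> by (simp add: z_def)
      then show False using z(2) e0 unfolding X_power_dvd_iff_nth by simp
    qed
    have "t = 0"
    proof (rule ccontr)
      assume "t \<noteq> 0"
      then have "z \<noteq> 0" "subdegree z = m" using s \<tau>_nz \<tau> by (simp_all add: z_def)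
      then show False using square_like_order[OF z(1)] by blast
    qed
    with s show ?thesis by blast
  qed
  have lin: "const2 s * U + const2 t * V \<in> vanishing_ideal 2"
    if "s * fps_nth (fps_nth U 0) 1 + t * fps_nth (fps_nth V 0) 1 = 0"
       "s * fps_nth (fps_nth U 1) 0 + t * fps_nth (fps_nth V 1) 0 = 0" for s t
    unfolding vanishing_ideal_def
  proof (intro CollectI allI impI)
    fix i j :: nat assume "i + j < 2"
    then consider "i = 0" "j = 0" | "i = 1" "j = 0" | "i = 0" "j = 1" by linarith
    then show "fps_nth (fps_nth (const2 s * U + const2 t * V) j) i = 0"
      by cases (use U1 V1 that in \<open>simp_all add: const2_def\<close>)
  qed
  show ?thesis
  proof (rule regular_parameters_if_independent[OF U1 V1], rule notI)
    assume det: "fps_nth (fps_nth U 0) 1 * fps_nth (fps_nth V 1) 0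
      = fps_nth (fps_nth U 1) 0 * fps_nth (fps_nth V 0) 1"
    \<comment> \<open>the two combinations that eliminate the linear coefficients of \<open>X\<close> and of \<open>Y\<close>; they are in the square of the maximal ideal because the determinant vanishes\<close>
    have 1: "fps_nth (fps_nth V 0) 1 = 0 \<and> - fps_nth (fps_nth U 0) 1 = 0"
      by (rule independent[OF lin]) (use det in \<open>simp_all add: algebra_simps\<close>)
    have 2: "fps_nth (fps_nth V 1) 0 = 0 \<and> - fps_nth (fps_nth U 1) 0 = 0"
      by (rule independent[OF lin]) (use det in \<open>simp_all add: algebra_simps\<close>)
    have "(1::'a) = 0 \<and> (0::'a) = 0"
      by (rule independent[OF lin]) (use 1 2 in simp_all)
    then show False by simp
  qed
qed

lemma monomial_branch_coprime:
  assumes red: "reduced_branch (range \<phi>) x y" and \<tau>: "subdegree \<tau> = 1"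
    and U: "\<phi> U = \<tau> ^ subdegree x" and V: "\<phi> V = \<tau> ^ subdegree y"
  shows "coprime (subdegree x) (subdegree y)"
proof -
  interpret reduced_branch "range \<phi>" x y by fact
  have UV: "regular_parameters U V" by (rule monomial_regular_parameters[OF assms])
  then obtain a b c d where X: "varX = a * U + b * V" and Y: "varY = c * U + d * V"
    unfolding regular_parameters_def by blast
  have "plane_branch (range \<phi>) (\<tau> ^ e) (\<tau> ^ m)"
  proof
    show "\<exists>c s1 s2. s1 \<in> range \<phi> \<and> s2 \<in> range \<phi> \<and> s = fps_const c + \<tau> ^ e * s1 + \<tau> ^ m * s2"
      if s: "s \<in> range \<phi>" for s
    proof -
      obtain g where g: "s = \<phi> g" using s by blast
      define k where "k = fps_nth (fps_nth g 0) 0"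
      obtain g1 g2 where "g = const2 k + varX * g1 + varY * g2"
        unfolding k_def by (rule local_decomposition)
      then have "g = const2 k + U * (a * g1 + c * g2) + V * (b * g1 + d * g2)"
        by (simp add: X Y algebra_simps)
      then have "s = fps_const k + \<tau> ^ e * \<phi> (a * g1 + c * g2) + \<tau> ^ m * \<phi> (b * g1 + d * g2)"
        unfolding g by (metis add mult const U V)
      then show ?thesis by blast
    qed
    show "\<tau> ^ e \<in> range \<phi>" "\<tau> ^ m \<in> range \<phi>" using U V by (metis rangeI)+
    show "2 \<le> subdegree (\<tau> ^ e)" using two_le_order \<tau> by simp
    show "fps_X ^ subdegree (\<tau> ^ e) dvd \<tau> ^ m"
      using \<tau> e_less_m unfolding X_power_dvd_iff_subdegree by simp
  qed (fact const_mem add_mem mult_mem conductor)+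
  then show ?thesis by (rule coprime_exponents[OF _ \<tau>])
qed

text \<open>
  Expand \<open>f\<close> in \<open>U\<close>, \<open>V\<close>. Its image is zero, and a monomial \<open>U^i V^j\<close> with \<open>i + j < e\<close> is the only one
  with its image, so all coefficients of degree \<open>< e\<close> vanish and \<open>f\<close> has order at least \<open>e\<close>. Since
  \<open>V^e - U^m\<close> is a multiple of \<open>f\<close> of order exactly \<open>e\<close>, the cofactor is a unit.
\<close>

lemma branch_equation:
  assumes red: "reduced_branch (range \<phi>) x y" and \<tau>: "subdegree \<tau> = 1"
    and U: "\<phi> U = \<tau> ^ subdegree x" and V: "\<phi> V = \<tau> ^ subdegree y"
  obtains g h where "V ^ subdegree x - U ^ subdegree y = f * g" "g * h = 1"
proof -
  interpret reduced_branch "range \<phi>" x y by fact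
  have UV: "regular_parameters U V" by (rule monomial_regular_parameters[OF assms])
  have cop: "coprime e m" by (rule monomial_branch_coprime[OF assms])
  have \<tau>0: "fps_nth \<tau> 0 = 0" by (rule nth_less_subdegree_zero) (simp add: \<tau>)
  obtain c :: "nat \<Rightarrow> nat \<Rightarrow> 'a" where c: "\<And>N. f - (\<Sum>(i, j) \<in> {(i, j). i + j < N}. const2 (c i j) * U ^ i * V ^ j)
      \<in> vanishing_ideal N"
    using expansion_in_regular_parameters[OF UV, of f] by blast
  have c0: "c i j = 0" if ij: "i + j < e" for i j
  proof -
    \<comment> \<open>the precision at which the monomial \<open>U^i V^j\<close> becomes visible in \<open>k[[t]]\<close>\<close>
    define K where "K = e * i + m * j + 1"
    have fin: "finite {(i, j). i + j < K}"
      by (rule finite_subset[of _ "{..<K} \<times> {..<K}"]) auto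
    have e0: "0 < e" "0 < m" using two_le_order e_less_m by linarith+
    have K: "i + j < K" using e0 unfolding K_def
      by (metis add_mono_thms_linordered_semiring(1) le_imp_less_Suc Suc_eq_plus1 mult_le_mono1
          mult_1 Suc_leI One_nat_def)
    define F where "F = (\<Sum>(i, j) \<in> {(i, j). i + j < K}. fps_const (c i j) * fps_X ^ (e * i + m * j))"
    have mono: "fps_X ^ (e * i + m * j) oo \<tau> = (\<tau> ^ e) ^ i * (\<tau> ^ m) ^ j" for i j
      unfolding fps_X_power_compose[OF \<tau>0] by (simp only: power_add power_mult)
    have "\<phi> (\<Sum>(i, j) \<in> {(i, j). i + j < K}. const2 (c i j) * U ^ i * V ^ j) = F oo \<tau>"
      unfolding F_def sum fps_compose_sum_distrib
      by (intro sum.cong refl)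
        (auto simp: mult const power U V fps_compose_mult_distrib[OF \<tau>0] mono mult.assoc)
    moreover have "\<phi> f = 0" using kernel by simp
    ultimately have "fps_X ^ K dvd F oo \<tau>" using continuous[OF c[of K]] by (simp add: diff)
    then have "F oo \<tau> = 0 \<or> K \<le> subdegree F"
      unfolding X_power_dvd_iff_subdegree using \<tau> \<tau>0 by simp
    moreover have "\<tau> \<noteq> 0" using \<tau> by auto
    ultimately have "F = 0 \<or> K \<le> subdegree F" using fps_compose_eq_0_iff[OF \<tau>0] by metis
    then have "fps_X ^ K dvd F" unfolding X_power_dvd_iff_subdegree .
    then have "fps_nth F (e * i + m * j) = 0" unfolding X_power_dvd_iff_nth K_def by simp
    moreover have "fps_nth F (e * i + m * j) = (\<Sum>p \<in> {(i, j). i + j < K}. if p = (i, j) then c i j else 0)"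
      unfolding F_def fps_sum_nth
    proof (intro sum.cong refl)
      fix p assume "p \<in> {(i, j). i + j < K}"
      obtain i' j' where p: "p = (i', j')" by fastforce
      show "fps_nth (case p of (i, j) \<Rightarrow> fps_const (c i j) * fps_X ^ (e * i + m * j)) (e * i + m * j)
          = (if p = (i, j) then c i j else 0)"
        using monomial_exponents_unique[OF cop e_less_m ij, of i' j']
        by (auto simp: p fps_X_power_nth)
    qed
    ultimately show ?thesis using fin K by (simp add: sum.delta)
  qed
  have fe: "f \<in> vanishing_ideal e"
  proof -
    have "(\<Sum>(i, j) \<in> {(i, j). i + j < e}. const2 (c i j) * U ^ i * V ^ j) = 0"
      by (intro sum.neutral) (auto simp: c0 const2_simps)
    then show ?thesis using c[of e] by simp
  qed
  have "\<phi> (V ^ e - U ^ m) = 0"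
    by (simp add: diff power U V flip: power_mult) (simp add: mult.commute)
  then obtain g where g: "V ^ e - U ^ m = f * g" using kernel by (auto elim: dvdE)
  have U1: "U \<in> vanishing_ideal 1" and V1: "V \<in> vanishing_ideal 1"
    using UV unfolding regular_parameters_def by blast+
  have "fps_nth (fps_nth g 0) 0 \<noteq> 0"
  proof
    assume "fps_nth (fps_nth g 0) 0 = 0"
    then have "g \<in> vanishing_ideal 1" by simp
    then have "V ^ e - U ^ m \<in> vanishing_ideal (e + 1)" unfolding g by (rule mult_vanishing[OF fe])
    moreover have "U ^ m \<in> vanishing_ideal (e + 1)"
      using vanishing_ideal_antimono[OF _ power_vanishing[OF U1]] e_less_m by simp
    ultimately have Ve: "V ^ e \<in> vanishing_ideal (Suc e)"
      using add_vanishing[of "V ^ e - U ^ m" "e + 1" "U ^ m"] by simp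
    have "fps_nth (fps_nth V 0) 1 \<noteq> 0 \<or> fps_nth (fps_nth V 1) 0 \<noteq> 0"
    proof (rule ccontr)
      assume no: "\<not> ?thesis"
      have V2: "V \<in> vanishing_ideal 2"
        unfolding vanishing_ideal_def
      proof (intro CollectI allI impI)
        fix i j :: nat assume "i + j < 2"
        then consider "i = 0" "j = 0" | "i = 1" "j = 0" | "i = 0" "j = 1" by linarith
        then show "fps_nth (fps_nth V j) i = 0" by cases (use V1 no in simp_all)
      qed
      obtain a b a' b' where X: "varX = a * U + b * V" and Y: "varY = a' * U + b' * V"
        using UV unfolding regular_parameters_def by blast
      have coeff: "fps_nth (fps_nth (r * U + s * V) 0) 1 = fps_nth (fps_nth r 0) 0 * fps_nth (fps_nth U 0) 1"
          "fps_nth (fps_nth (r * U + s * V) 1) 0 = fps_nth (fps_nth r 0) 0 * fps_nth (fps_nth U 1) 0" for r s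
        using no U1 V1 by (simp_all add: fps_mult_nth)
      have "fps_nth (fps_nth (varX :: 'a fps fps) 0) 1 = 1" "fps_nth (fps_nth (varX :: 'a fps fps) 1) 0 = 0"
          "fps_nth (fps_nth (varY :: 'a fps fps) 1) 0 = 1" "fps_nth (fps_nth (varY :: 'a fps fps) 0) 1 = 0"
        by (simp_all add: varX_def varY_def)
      then show False using coeff[of a b] coeff[of a' b'] unfolding X[symmetric] Y[symmetric]
        by (metis mult_eq_0_iff zero_neq_one)
    qed
    then show False using power_not_vanishing[OF V1, of e] Ve by blast
  qed
  then obtain h where "g * h = 1" by (rule unit_if_constant_term)
  then show ?thesis using that g by blast
qed

end

section \<open>The ideals and quotients of k[[X,Y]]\<close>

lemma kXY_simps:
  "carrier kXY = UNIV" "x \<otimes>\<^bsub>kXY\<^esub> y = x * y" "\<one>\<^bsub>kXY\<^esub> = 1"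
  "\<zero>\<^bsub>kXY\<^esub> = 0" "x \<oplus>\<^bsub>kXY\<^esub> y = x + y"
  by (simp_all add: ring_of_type_algebra_def)

lemma cring_kXY: "cring (kXY :: 'a::field fps fps ring)"
  by (rule cring_from_type_algebra)

lemma ideal_vanishing_ideal: "ideal (vanishing_ideal N) (kXY :: 'a::field fps fps ring)"
proof -
  interpret cring "kXY :: 'a fps fps ring" by (rule cring_kXY)
  show ?thesis
  proof (rule idealI)
    show "ring (kXY :: 'a fps fps ring)" by (rule ring_axioms)
    show "subgroup (vanishing_ideal N) (add_monoid (kXY :: 'a fps fps ring))"
    proof (rule add.subgroupI)
      show "vanishing_ideal N \<noteq> ({} :: 'a fps fps set)" using zero_vanishing by blast
      show "\<ominus>\<^bsub>kXY\<^esub> g \<in> vanishing_ideal N" if "g \<in> vanishing_ideal N" for g :: "'a fps fps"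
      proof -
        have "\<ominus>\<^bsub>kXY\<^esub> g = - g"
          by (rule minus_equality) (simp_all add: kXY_simps)
        then show ?thesis using diff_vanishing[OF zero_vanishing that] by simp
      qed
    qed (use zero_vanishing add_vanishing in \<open>auto simp: kXY_simps\<close>)
  qed (use mult_vanishing_left in \<open>auto simp: kXY_simps mult.commute\<close>)
qed

lemma max_ideal_eq: "max_ideal = (vanishing_ideal 1 :: 'a::field fps fps set)"
proof -
  interpret cring "kXY :: 'a fps fps ring" by (rule cring_kXY)
  have id: "ideal (Idl\<^bsub>kXY\<^esub> {varX, varY}) (kXY :: 'a fps fps ring)"
    by (rule genideal_ideal) (simp add: kXY_simps)
  have sub: "{varX, varY} \<subseteq> Idl\<^bsub>kXY\<^esub> {varX, varY :: 'a fps fps}"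
    by (rule genideal_self) (simp add: kXY_simps)
  show ?thesis unfolding max_ideal_def
  proof
    show "Idl\<^bsub>kXY\<^esub> {varX, varY :: 'a fps fps} \<subseteq> vanishing_ideal 1"
      by (rule genideal_minimal[OF ideal_vanishing_ideal]) (use var_vanishing in auto)
    show "vanishing_ideal 1 \<subseteq> Idl\<^bsub>kXY\<^esub> {varX, varY :: 'a fps fps}"
    proof
      fix g :: "'a fps fps" assume "g \<in> vanishing_ideal 1"
      then have "g \<in> vanishing_ideal (Suc 0)" by simp
      then obtain g1 g2 where g: "g = varX * g1 + varY * g2" by (rule vanishing_ideal_Suc)
      have "varX \<otimes>\<^bsub>kXY\<^esub> g1 \<oplus>\<^bsub>kXY\<^esub> varY \<otimes>\<^bsub>kXY\<^esub> g2 \<in> Idl\<^bsub>kXY\<^esub> {varX, varY}"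
        using sub by (intro additive_subgroup.a_closed[OF ideal.axioms(1)[OF id]]
            ideal.I_r_closed[OF id]) (auto simp: kXY_simps)
      then show "g \<in> Idl\<^bsub>kXY\<^esub> {varX, varY}" by (simp add: g kXY_simps)
    qed
  qed
qed

lemma max_ideal_pow_eq: "max_ideal_pow N = (vanishing_ideal N :: 'a::field fps fps set)"
proof (induction N)
  case 0
  then show ?case
    by (simp add: max_ideal_pow_def nat_pow_def ideals_set_def kXY_simps vanishing_ideal_0)
next
  case (Suc N)
  have "max_ideal_pow (Suc N) = ideal_prod kXY (vanishing_ideal N) (vanishing_ideal 1 :: 'a fps fps set)"
    using Suc by (simp add: max_ideal_pow_def nat_pow_def ideals_set_def max_ideal_eq)
  also have "\<dots> = vanishing_ideal (Suc N)"
  proof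
    show "ideal_prod kXY (vanishing_ideal N) (vanishing_ideal 1) \<subseteq> (vanishing_ideal (Suc N) :: 'a fps fps set)"
    proof
      fix g :: "'a fps fps" assume "g \<in> ideal_prod kXY (vanishing_ideal N) (vanishing_ideal 1)"
      then show "g \<in> vanishing_ideal (Suc N)"
      proof induction
        case (prod i j)
        then show ?case using mult_vanishing[of i N j 1] by (simp add: kXY_simps)
      qed (simp add: kXY_simps add_vanishing)
    qed
    show "vanishing_ideal (Suc N) \<subseteq> ideal_prod kXY (vanishing_ideal N) (vanishing_ideal 1 :: 'a fps fps set)"
    proof
      fix g :: "'a fps fps" assume "g \<in> vanishing_ideal (Suc N)"
      then obtain g1 g2 where g: "g1 \<in> vanishing_ideal N" "g2 \<in> vanishing_ideal N"
          "g = varX * g1 + varY * g2" by (rule vanishing_ideal_Suc)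
      have "g1 \<otimes>\<^bsub>kXY\<^esub> varX \<oplus>\<^bsub>kXY\<^esub> g2 \<otimes>\<^bsub>kXY\<^esub> varY \<in> ideal_prod kXY (vanishing_ideal N) (vanishing_ideal 1)"
        using g var_vanishing by (intro ideal_prod.sum ideal_prod.prod)
      then show "g \<in> ideal_prod kXY (vanishing_ideal N) (vanishing_ideal 1)"
        by (simp add: kXY_simps g(3) mult.commute)
    qed
  qed
  finally show ?case .
qed

text \<open>
  The greatest element defining the order exists because a nonzero coefficient of \<open>f\<close> bounds the
  powers of the maximal ideal containing it.
\<close>

lemma ps_order_vanishing:
  assumes "f \<noteq> 0"
  shows "f \<in> vanishing_ideal (ps_order f)"
proof -
  obtain i j where nz: "fps_nth (fps_nth f j) i \<noteq> 0" using assms by (metis fps_ext fps_zero_nth)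
  have "(GREATEST N. f \<in> max_ideal_pow N) = ps_order f" by (simp add: ps_order_def)
  moreover have "f \<in> max_ideal_pow (GREATEST N. f \<in> max_ideal_pow N)"
  proof (rule GreatestI_nat[of _ 0 "i + j"])
    show "f \<in> max_ideal_pow 0" by (simp add: max_ideal_pow_eq vanishing_ideal_0)
    show "N \<le> i + j" if "f \<in> max_ideal_pow N" for N
      using that nz unfolding max_ideal_pow_eq by (meson vanishing_idealD not_le)
  qed
  ultimately show ?thesis by (simp add: max_ideal_pow_eq)
qed

lemma pair_of_variables_if_regular_parameters:
  assumes "regular_parameters U V"
  shows "pair_of_variables U V"
proof -
  have "h \<in> ps_subring U V" for h
    using expansion_in_regular_parameters[OF assms, of h]
    unfolding ps_subring_def max_ideal_pow_eq by blast
  then show ?thesis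
    using assms unfolding pair_of_variables_def regular_parameters_def max_ideal_eq by blast
qed

lemma PIdl_kXY: "PIdl\<^bsub>kXY\<^esub> f = {g. f dvd g}"
  by (auto simp: cgenideal_def kXY_simps dvd_def mult.commute)

lemma ideal_PIdl_kXY: "ideal (PIdl\<^bsub>kXY\<^esub> f) (kXY :: 'a::field fps fps ring)"
proof -
  interpret cring "kXY :: 'a fps fps ring" by (rule cring_kXY)
  show ?thesis by (rule cgenideal_ideal) (simp add: kXY_simps)
qed

text \<open>
  As an element of the integral closure, \<open>t\<close> lies in the field of fractions of the branch; this makes
  it a quotient of two values of \<open>\<phi>\<close>.
\<close>

lemma parametrization_of_normalization:
  fixes f :: "'a::field_char_0 fps fps"
  assumes norm: "normalization f \<iota>" and sing: "f \<in> vanishing_ideal 2"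
  defines "\<phi> \<equiv> \<lambda>g. \<iota> (PIdl\<^bsub>kXY\<^esub> f +>\<^bsub>kXY\<^esub> g)"
  shows "parametrization \<phi> f" "\<iota> ` carrier (curve_ring f) = range \<phi>"
proof -
  interpret I: ideal "PIdl\<^bsub>kXY\<^esub> f" "kXY :: 'a fps fps ring" by (rule ideal_PIdl_kXY)
  define \<pi> where "\<pi> g = PIdl\<^bsub>kXY\<^esub> f +>\<^bsub>kXY\<^esub> g" for g
  have \<phi>: "\<phi> g = \<iota> (\<pi> g)" for g by (simp add: \<phi>_def \<pi>_def)
  have \<pi>_hom: "\<pi> \<in> ring_hom kXY (curve_ring f)"
    using I.rcos_ring_hom unfolding curve_ring_def \<pi>_def[abs_def] .
  have carrier: "carrier (curve_ring f) = range \<pi>"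
    unfolding curve_ring_def by (auto simp: FactRing_def A_RCOSETS_def' kXY_simps \<pi>_def)
  have \<iota>_hom: "\<iota> \<in> ring_hom (curve_ring f) ring_of_type_algebra"
    and inj: "inj_on \<iota> (carrier (curve_ring f))"
    and \<iota>_const: "\<And>c. \<iota> (curve_const f c) = fps_const c"
    and closure: "integral_closure (fps_to_fls ` \<iota> ` carrier (curve_ring f)) = range fps_to_fls"
    using norm unfolding normalization_def by auto
  show range: "\<iota> ` carrier (curve_ring f) = range \<phi>"
    unfolding carrier by (auto simp: \<phi>)
  have add: "\<phi> (g + h) = \<phi> g + \<phi> h" for g h
    using ring_hom_add[OF \<pi>_hom, of g h] ring_hom_add[OF \<iota>_hom, of "\<pi> g" "\<pi> h"]
    unfolding carrier by (simp add: \<phi> kXY_simps) (simp add: ring_of_type_algebra_def)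
  have mult: "\<phi> (g * h) = \<phi> g * \<phi> h" for g h
    using ring_hom_mult[OF \<pi>_hom, of g h] ring_hom_mult[OF \<iota>_hom, of "\<pi> g" "\<pi> h"]
    unfolding carrier by (simp add: \<phi> kXY_simps) (simp add: ring_of_type_algebra_def)
  have zero: "\<phi> 0 = 0" using add[of 0 0] by simp
  show "parametrization \<phi> f"
  proof
    show "\<phi> (g + h) = \<phi> g + \<phi> h" "\<phi> (g * h) = \<phi> g * \<phi> h" for g h by (fact add mult)+
    show "\<phi> (const2 c) = fps_const c" for c
      using \<iota>_const[of c] by (simp add: \<phi>_def curve_const_def)
    show "\<phi> g = 0 \<longleftrightarrow> f dvd g" for g
    proof -
      have "\<phi> g = 0 \<longleftrightarrow> \<pi> g = \<pi> 0"
        using inj zero unfolding \<phi> carrier by (metis inj_onD rangeI)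
      also have "\<dots> \<longleftrightarrow> g \<in> PIdl\<^bsub>kXY\<^esub> f"
      proof
        assume "\<pi> g = \<pi> 0"
        then have "g \<in> \<pi> 0" using I.a_rcos_self[of g] by (simp add: \<pi>_def kXY_simps)
        then show "g \<in> PIdl\<^bsub>kXY\<^esub> f"
          by (auto simp: \<pi>_def a_r_coset_def' kXY_simps)
      next
        assume "g \<in> PIdl\<^bsub>kXY\<^esub> f"
        then show "\<pi> g = \<pi> 0"
          using I.a_rcos_const[of g] I.a_rcos_const[of 0]
          by (simp add: \<pi>_def PIdl_kXY)
      qed
      finally show ?thesis by (simp add: PIdl_kXY)
    qed
    show "\<exists>u v. \<phi> v \<noteq> 0 \<and> \<phi> v * fps_X = \<phi> u"
    proof -
      have "fps_to_fls fps_X \<in> fractions (fps_to_fls ` range \<phi>)"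
        using closure unfolding integral_closure_def range by blast
      then obtain u v where uv: "fps_to_fls (\<phi> v) \<noteq> 0" "fps_to_fls fps_X = fps_to_fls (\<phi> u) / fps_to_fls (\<phi> v)"
        unfolding fractions_def by blast
      then have "fps_to_fls (\<phi> v * fps_X) = fps_to_fls (\<phi> u)"
        by (simp add: fls_times_fps_to_fls del: fps_X_to_fls)
      then show ?thesis using uv(1) by (intro exI[of _ u] exI[of _ v]) simp
    qed
    show "f \<in> vanishing_ideal 2" by (rule sing)
  qed
qed

section \<open>The order bound\<close>

theorem theorem3p1:
  fixes f :: "'a::{alg_closed_field, field_char_0} fps fps"
    and n r :: nat
    and D :: "'a fps fps set \<Rightarrow> 'a fps fps set"
    and \<iota> :: "'a fps fps set \<Rightarrow> 'a fps"
    and a :: "'a fps"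
  assumes "Factorial_Ring.irreducible f"
    and "ps_order f = n" and "n \<ge> 2"
    and "\<not> quasi_homogeneous f"
    and "k_derivation (curve_ring f) (curve_const f) D"
    and "\<exists>u\<in>carrier (curve_ring f). D u \<noteq> \<zero>\<^bsub>curve_ring f\<^esub>"
    and "normalization f \<iota>"
    and "induced_by f \<iota> a D"
    and "r = subdegree a"
  shows "r \<ge> n + 1"
proof (rule ccontr)
  assume small: "\<not> n + 1 \<le> r"
  have "f \<noteq> 0" using assms(1) by auto
  then have fn: "f \<in> vanishing_ideal n" using ps_order_vanishing assms(2) by blast
  then have f2: "f \<in> vanishing_ideal 2" using vanishing_ideal_antimono[OF assms(3)] by blast
  define \<phi> where "\<phi> g = \<iota> (PIdl\<^bsub>kXY\<^esub> f +>\<^bsub>kXY\<^esub> g)" for g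
  interpret parametrization \<phi> f
    using parametrization_of_normalization(1)[OF assms(7) f2] by (simp add: \<phi>_def[abs_def])
  have S: "\<iota> ` carrier (curve_ring f) = range \<phi>"
    using parametrization_of_normalization(2)[OF assms(7) f2] by (simp add: \<phi>_def[abs_def])
  have stable: "a * fps_deriv s \<in> range \<phi>" if "s \<in> range \<phi>" for s
    using that assms(8) unfolding induced_by_def S[symmetric] by blast
  have "a \<noteq> 0"
  proof
    assume "a = 0"
    obtain u where u: "u \<in> carrier (curve_ring f)" "D u \<noteq> \<zero>\<^bsub>curve_ring f\<^esub>" using assms(6) by blast
    interpret I: ideal "PIdl\<^bsub>kXY\<^esub> f" "kXY :: 'a fps fps ring" by (rule ideal_PIdl_kXY)
    interpret R: ring "curve_ring f" unfolding curve_ring_def by (rule I.quotient_is_ring)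
    have \<iota>: "\<iota> \<in> ring_hom (curve_ring f) ring_of_type_algebra" "inj_on \<iota> (carrier (curve_ring f))"
      using assms(7) unfolding normalization_def by auto
    have "\<iota> (\<zero>\<^bsub>curve_ring f\<^esub>) = 0"
      using ring_hom_add[OF \<iota>(1) R.zero_closed R.zero_closed] by (simp add: ring_of_type_algebra_def)
    moreover have "\<iota> (D u) = 0" using assms(8) u(1) \<open>a = 0\<close> unfolding induced_by_def by simp
    moreover have "D u \<in> carrier (curve_ring f)" using assms(5) u(1) unfolding k_derivation_def by blast
    ultimately show False using u(2) \<iota>(2) R.zero_closed by (metis inj_onD)
  qed
  obtain x y where red: "reduced_branch (range \<phi>) x y"
      and order: "\<And>N. f \<in> vanishing_ideal N \<Longrightarrow> N \<le> subdegree x"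
    using branch_coordinates by blast
  interpret reduced_branch "range \<phi>" x y by (fact red)
  have "subdegree a \<le> e" using order[OF fn] small assms(9) by linarith
  with \<open>a \<noteq> 0\<close> stable obtain \<tau> where \<tau>: "subdegree \<tau> = 1" "\<tau> ^ e \<in> range \<phi>" "\<tau> ^ m \<in> range \<phi>"
    by (rule monomial_generators)
  then obtain U V where UV: "\<phi> U = \<tau> ^ e" "\<phi> V = \<tau> ^ m" by (metis rangeE)
  obtain g h where gh: "V ^ e - U ^ m = f * g" "g * h = 1"
    using branch_equation[OF red \<tau>(1) UV] .
  have "pair_of_variables U V"
    by (intro pair_of_variables_if_regular_parameters monomial_regular_parameters[OF red \<tau>(1) UV])
  moreover have "PIdl\<^bsub>kXY\<^esub> f = PIdl\<^bsub>kXY\<^esub> (V ^ e - U ^ m)"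
  proof -
    have "f dvd V ^ e - U ^ m" by (simp add: gh(1))
    moreover have "f = (V ^ e - U ^ m) * h" by (simp add: gh mult.assoc)
    then have "V ^ e - U ^ m dvd f" by (rule dvdI)
    ultimately show ?thesis unfolding PIdl_kXY by (auto intro: dvd_trans)
  qed
  moreover have "2 \<le> e" "2 \<le> m" using two_le_order e_less_m by linarith+
  ultimately have "quasi_homogeneous f"
    using assms(1,2,3) unfolding quasi_homogeneous_def by (intro conjI) auto
  then show False using assms(4) by contradiction
qed

end
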